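(* Let $K$ be a torus knot $T_{p,q}$ with $p>q\ge2$ coprime. (i) There is no infinite ascending chain $\langle\!\langle r_1\rangle\!\rangle\subset\langle\!\langle r_2\rangle\!\rangle\subset\langle\!\langle r_3\rangle\!\rangle\subset\cdots$ with mutually distinct slopes $r_i$ of $K$. (ii) For each finite surgery slope $r\in\mathbb{Q}$ of $K$, there exists an infinite descending chain $\langle\!\langle r\rangle\!\rangle\supset\langle\!\langle r_1\rangle\!\rangle\supset\langle\!\langle r_2\rangle\!\rangle\supset\cdots$ with mutually distinct slopes $r,r_1,r_2,\dots$ of $K$.
   Context: For a nontrivial knot $K\subset S^3$ with exterior $E(K)$, let $G(K)=\pi_1(E(K),* )$ with base point $*\in\partial E(K)$, and fix a standard (preferred) meridian-longitude pair $(\mu,\lambda)$ in the peripheral subgroup $P(K)$, the (injective) image of $\pi_1(\partial E(K),* )$ in $G(K)$. A slope (isotopy class of essential unoriented simple closed curves on $\partial E(K)$) is identified with $m/n\in\mathbb{Q}\cup\{\infty\}$ ($m,n$ coprime), corresponding to $(\mu^m\lambda^n)^{\pm1}$; $\infty=1/0$ is the meridional slope. $\langle\!\langle m/n \rangle\!\rangle$ denotes the normal closure of $\mu^m\lambda^n$ in $G(K)$. $K(r)$ is the closed 3-manifold obtained from $E(K)$ by $r$-Dehn filling, so $\pi_1(K(r))=G(K)/\langle\!\langle r\rangle\!\rangle$. A slope $r$ is a finite surgery slope if $\pi_1(K(r))$ is finite. *)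

theory Defs
  imports "HOL-Analysis.Analysis" "HOL-Algebra.Generated_Groups"
begin

section \<open>The fundamental group\<close>

definition loops_at :: "'a::real_normed_vector set \<Rightarrow> 'a \<Rightarrow> (real \<Rightarrow> 'a) set" where
  "loops_at S a = {g. path g \<and> path_image g \<subseteq> S \<and> pathstart g = a \<and> pathfinish g = a}"

definition path_class :: "'a::real_normed_vector set \<Rightarrow> (real \<Rightarrow> 'a) \<Rightarrow> (real \<Rightarrow> 'a) set" where
  "path_class S g = {h. homotopic_paths S g h}"

definition fundamental_group :: "'a::real_normed_vector set \<Rightarrow> 'a \<Rightarrow> (real \<Rightarrow> 'a) set monoid" where
  "fundamental_group S a =
    \<lparr>carrier = path_class S ` loops_at S a,
     mult = (\<lambda>X Y. \<Union>g\<in>X. \<Union>h\<in>Y. path_class S (g +++ h)),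
     one = path_class S (linepath a a)\<rparr>"

lemma path_class_eqI: "homotopic_paths S g h \<Longrightarrow> path_class S g = path_class S h"
  unfolding path_class_def by (blast intro: homotopic_paths_trans homotopic_paths_sym)

lemma loops_at_join: "g \<in> loops_at S a \<Longrightarrow> h \<in> loops_at S a \<Longrightarrow> g +++ h \<in> loops_at S a"
  by (auto simp: loops_at_def path_image_join)

lemma mult_fundamental_group:
  assumes "g \<in> loops_at S a" "h \<in> loops_at S a"
  shows "path_class S g \<otimes>\<^bsub>fundamental_group S a\<^esub> path_class S h = path_class S (g +++ h)"
proof -
  have "path_class S (g' +++ h') = path_class S (g +++ h)"
    if "g' \<in> path_class S g" "h' \<in> path_class S h" for g' h'
  proof -
    have "homotopic_paths S g' g" "homotopic_paths S h' h"
      using that by (auto simp: path_class_def homotopic_paths_sym)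
    moreover from this have "pathfinish g' = pathstart h'"
      using assms homotopic_paths_imp_pathfinish homotopic_paths_imp_pathstart
      by (fastforce simp: loops_at_def)
    ultimately show ?thesis
      by (intro path_class_eqI homotopic_paths_join)
  qed
  moreover have "g \<in> path_class S g" "h \<in> path_class S h"
    using assms by (auto simp: path_class_def loops_at_def)
  ultimately have "(\<Union>g'\<in>path_class S g. \<Union>h'\<in>path_class S h. path_class S (g' +++ h'))
      = path_class S (g +++ h)"
    by blast
  then show ?thesis
    by (simp add: fundamental_group_def)
qed

lemma group_fundamental_group:
  assumes "a \<in> S"
  shows "group (fundamental_group S a)"
proof (rule groupI)
  let ?G = "fundamental_group S a"
  have car: "carrier ?G = path_class S ` loops_at S a"
    and one: "\<one>\<^bsub>?G\<^esub> = path_class S (linepath a a)"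
    by (auto simp: fundamental_group_def)
  have const: "linepath a a \<in> loops_at S a"
    using assms by (auto simp: loops_at_def)
  show "x \<otimes>\<^bsub>?G\<^esub> y \<in> carrier ?G" if "x \<in> carrier ?G" "y \<in> carrier ?G" for x y
    using that by (auto simp: car mult_fundamental_group loops_at_join)
  show "\<one>\<^bsub>?G\<^esub> \<in> carrier ?G"
    using const by (auto simp: car one)
  show "x \<otimes>\<^bsub>?G\<^esub> y \<otimes>\<^bsub>?G\<^esub> z = x \<otimes>\<^bsub>?G\<^esub> (y \<otimes>\<^bsub>?G\<^esub> z)"
    if xyz: "x \<in> carrier ?G" "y \<in> carrier ?G" "z \<in> carrier ?G" for x y z
  proof -
    obtain f g h where *: "f \<in> loops_at S a" "g \<in> loops_at S a" "h \<in> loops_at S a"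
      "x = path_class S f" "y = path_class S g" "z = path_class S h"
      using xyz unfolding car by blast
    moreover have "homotopic_paths S (f +++ (g +++ h)) ((f +++ g) +++ h)"
      using * by (intro homotopic_paths_assoc) (auto simp: loops_at_def)
    ultimately show ?thesis
      by (simp add: mult_fundamental_group loops_at_join path_class_eqI)
  qed
  show "\<one>\<^bsub>?G\<^esub> \<otimes>\<^bsub>?G\<^esub> x = x" if x: "x \<in> carrier ?G" for x
  proof -
    obtain f where f: "f \<in> loops_at S a" "x = path_class S f"
      using x unfolding car by blast
    moreover have "homotopic_paths S (linepath a a +++ f) f"
      using f homotopic_paths_lid[of f S] by (auto simp: loops_at_def)
    ultimately show ?thesis
      by (simp add: one mult_fundamental_group const path_class_eqI)
  qed
  show "\<exists>y\<in>carrier ?G. y \<otimes>\<^bsub>?G\<^esub> x = \<one>\<^bsub>?G\<^esub>" if x: "x \<in> carrier ?G" for x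
  proof -
    obtain f where f: "f \<in> loops_at S a" "x = path_class S f"
      using x unfolding car by blast
    then have r: "reversepath f \<in> loops_at S a"
      by (auto simp: loops_at_def)
    have "homotopic_paths S (reversepath f +++ f) (linepath a a)"
      using f homotopic_paths_linv[of f S] by (auto simp: loops_at_def)
    then have "path_class S (reversepath f) \<otimes>\<^bsub>?G\<^esub> x = \<one>\<^bsub>?G\<^esub>"
      by (simp add: one f r mult_fundamental_group path_class_eqI)
    then show ?thesis
      using r by (auto simp: car)
  qed
qed

definition normal_closure :: "('a, 'b) monoid_scheme \<Rightarrow> 'a set \<Rightarrow> 'a set" where
  "normal_closure G A = \<Inter>{N. N \<lhd> G \<and> A \<subseteq> N}"


section \<open>Knot exteriors, meridians and longitudes\<close>

text \<open>
  The 3-sphere is \<^term>\<open>sphere (0::complex \<times> complex) 1\<close>, oriented as the boundary of the unit ball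
  of \<open>C\<^sup>2\<close>. An oriented knot comes with a tubular neighbourhood, given by an
  orientation preserving embedding \<open>\<phi>\<close> of (a neighbourhood of the unit-radius solid torus in)
  \<open>S\<^sup>1 \<times> C\<close>, where \<open>\<phi>\<close> restricted to \<open>S\<^sup>1 \<times> 0\<close> parametrises the knot. The framing
  of \<open>\<phi>\<close> is arbitrary.
\<close>

type_synonym tube = "complex \<times> complex \<Rightarrow> complex \<times> complex"

definition knot_exterior :: "tube \<Rightarrow> (complex \<times> complex) set" where
  "knot_exterior \<phi> = sphere 0 1 - \<phi> ` (sphere 0 1 \<times> ball 0 1)"

definition knot_group :: "tube \<Rightarrow> (real \<Rightarrow> complex \<times> complex) set monoid" where
  "knot_group \<phi> = fundamental_group (knot_exterior \<phi>) (\<phi> (1, 1))"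

definition meridian :: "tube \<Rightarrow> (real \<Rightarrow> complex \<times> complex) set" where
  "meridian \<phi> = path_class (knot_exterior \<phi>) (\<lambda>t. \<phi> (1, cis (2 * pi * t)))"

text \<open>The curves on the boundary torus that run once along the knot, with \<open>k\<close> twists relative to
  the framing of \<open>\<phi>\<close>.\<close>

definition longitude :: "tube \<Rightarrow> int \<Rightarrow> (real \<Rightarrow> complex \<times> complex) set" where
  "longitude \<phi> k =
    path_class (knot_exterior \<phi>) (\<lambda>t. \<phi> (cis (2 * pi * t), cis (2 * pi * of_int k * t)))"

text \<open>The preferred longitude is the one that is null-homologous in the exterior; the first homology
  group is the abelianisation of the knot group.\<close>

definition preferred_pair ::
  "tube \<Rightarrow> (real \<Rightarrow> complex \<times> complex) set \<Rightarrow> (real \<Rightarrow> complex \<times> complex) set \<Rightarrow> bool" where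
  "preferred_pair \<phi> \<mu> l \<longleftrightarrow>
     \<mu> = meridian \<phi> \<and> (\<exists>k. l = longitude \<phi> k) \<and>
     l \<in> derived (knot_group \<phi>) (carrier (knot_group \<phi>))"


section \<open>Slopes\<close>

datatype slope = Rational rat | Infinity

text \<open>The slope \<open>m/n\<close> (in lowest terms) is represented by the element \<open>\<mu>\<^sup>m \<lambda>\<^sup>n\<close>; the choice
  \<open>n > 0\<close> made by \<^const>\<open>quotient_of\<close> does not affect the normal closure.\<close>

fun slope_element :: "('a, 'b) monoid_scheme \<Rightarrow> 'a \<Rightarrow> 'a \<Rightarrow> slope \<Rightarrow> 'a" where
  "slope_element G \<mu> l (Rational r) =
     (let (m, n) = quotient_of r in (\<mu> [^]\<^bsub>G\<^esub> m) \<otimes>\<^bsub>G\<^esub> (l [^]\<^bsub>G\<^esub> n))"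
| "slope_element G \<mu> l Infinity = \<mu>"

definition slope_closure :: "('a, 'b) monoid_scheme \<Rightarrow> 'a \<Rightarrow> 'a \<Rightarrow> slope \<Rightarrow> 'a set" where
  "slope_closure G \<mu> l r = normal_closure G {slope_element G \<mu> l r}"

text \<open>The group of the Dehn filling \<open>K(r)\<close>.\<close>

definition surgery_group ::
  "('a, 'b) monoid_scheme \<Rightarrow> 'a \<Rightarrow> 'a \<Rightarrow> slope \<Rightarrow> 'a set monoid" where
  "surgery_group G \<mu> l r = G Mod slope_closure G \<mu> l r"

definition finite_surgery_slope :: "('a, 'b) monoid_scheme \<Rightarrow> 'a \<Rightarrow> 'a \<Rightarrow> slope \<Rightarrow> bool" where
  "finite_surgery_slope G \<mu> l r \<longleftrightarrow> finite (carrier (surgery_group G \<mu> l r))"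


section \<open>Torus knots\<close>

definition torus_knot :: "nat \<Rightarrow> nat \<Rightarrow> (complex \<times> complex) set" where
  "torus_knot p q = {(u ^ p / of_real (sqrt 2), u ^ q / of_real (sqrt 2)) | u :: complex. u \<in> sphere 0 1}"

text \<open>
  Write a point of the 3-sphere off the two core circles as \<open>(sin(\<pi>/4 + s) e\<^sup>i\<^sup>\<alpha>, cos(\<pi>/4 + s) e\<^sup>i\<^sup>\<beta>)\<close>;
  then \<open>(\<alpha>, \<beta>, s)\<close> are positively oriented coordinates in which the torus knot is
  \<open>\<theta> \<mapsto> (p \<theta>, q \<theta>, 0)\<close>. The tube below displaces it by \<open>Re v\<close> times
  \<open>(-q, p, 0) / (p\<^sup>2 + q\<^sup>2)\<close> and by \<open>Im v / 2\<close> times \<open>(0, 0, 1)\<close>, so that it preserves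
  orientation; the lemmas below show that it is an embedding beyond the unit-radius solid torus.
\<close>

definition torus_knot_tube :: "nat \<Rightarrow> nat \<Rightarrow> tube" where
  "torus_knot_tube p q = (\<lambda>(u, v).
     (of_real (sin (pi / 4 + Im v / 2)) * u ^ p * cis (- real q * Re v / (real p ^ 2 + real q ^ 2)),
      of_real (cos (pi / 4 + Im v / 2)) * u ^ q * cis (real p * Re v / (real p ^ 2 + real q ^ 2))))"

lemma torus_knot_tube_core: "torus_knot_tube p q ` (sphere 0 1 \<times> {0}) = torus_knot p q"
proof -
  have "sin (pi / 4) = 1 / sqrt 2" "cos (pi / 4) = 1 / sqrt 2"
    by (simp_all add: sin_45 cos_45 real_div_sqrt field_simps)
  then have "torus_knot_tube p q (u, 0) = (u ^ p / of_real (sqrt 2), u ^ q / of_real (sqrt 2))" for u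
    by (simp add: torus_knot_tube_def)
  moreover have "sphere (0::complex) 1 \<times> {0::complex} = (\<lambda>u. (u, 0)) ` sphere 0 1"
    by auto
  ultimately show ?thesis
    unfolding torus_knot_def by (simp only: image_image Setcompr_eq_image)
qed

lemma torus_knot_tube_in_sphere:
  assumes "u \<in> sphere 0 1"
  shows "torus_knot_tube p q (u, v) \<in> sphere 0 1"
  using assms by (simp add: torus_knot_tube_def norm_Pair norm_mult norm_power)

lemma continuous_on_torus_knot_tube: "continuous_on A (torus_knot_tube p q)"
proof -
  have "continuous_on A (\<lambda>x.
     (of_real (sin (pi / 4 + Im (snd x) / 2)) * fst x ^ p * cis (a * Re (snd x) * c),
      of_real (cos (pi / 4 + Im (snd x) / 2)) * fst x ^ q * cis (b * Re (snd x) * c)))"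
    for a b c
    unfolding cis_conv_exp by (intro continuous_intros) simp_all
  then show ?thesis
    unfolding torus_knot_tube_def case_prod_unfold by (simp only: divide_inverse[of "_ * Re _"])
qed

lemma inj_on_torus_knot_tube:
  assumes "coprime p q" "p > 0" "q > 0"
  shows "inj_on (torus_knot_tube p q) (sphere 0 1 \<times> cball 0 (3 / 2))"
proof (rule inj_onI, clarify)
  fix u v u' v'
  assume u: "u \<in> sphere 0 1" "u' \<in> sphere 0 1" and v: "v \<in> cball 0 (3 / 2)" "v' \<in> cball 0 (3 / 2)"
    and eq: "torus_knot_tube p q (u, v) = torus_knot_tube p q (u', v')"
  define N where "N = real p ^ 2 + real q ^ 2"
  have N: "N > 0"
    using assms by (simp add: N_def add_pos_pos)
  have bound: "\<bar>Im w / 2\<bar> < pi / 4" "\<bar>Re w\<bar> \<le> 3 / 2" if "w \<in> cball 0 (3 / 2)" for w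
    using that abs_Im_le_cmod[of w] abs_Re_le_cmod[of w] pi_gt3 by auto
  have sin_pos: "sin (pi / 4 + Im w / 2) > 0" and cos_pos: "cos (pi / 4 + Im w / 2) > 0"
    if "w \<in> cball 0 (3 / 2)" for w
    using bound(1)[OF that] by (auto intro!: sin_gt_zero cos_gt_zero_pi)
  have eq1: "of_real (sin (pi / 4 + Im v / 2)) * u ^ p * cis (- real q * Re v / N)
           = of_real (sin (pi / 4 + Im v' / 2)) * u' ^ p * cis (- real q * Re v' / N)"
    and eq2: "of_real (cos (pi / 4 + Im v / 2)) * u ^ q * cis (real p * Re v / N)
           = of_real (cos (pi / 4 + Im v' / 2)) * u' ^ q * cis (real p * Re v' / N)"
    using eq by (simp_all add: torus_knot_tube_def N_def)
  have sin_eq: "sin (pi / 4 + Im v / 2) = sin (pi / 4 + Im v' / 2)"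
    using arg_cong[OF eq1, of norm] u sin_pos[OF v(1)] sin_pos[OF v(2)]
    by (simp add: norm_mult norm_power)
  have "pi / 4 + Im v / 2 = pi / 4 + Im v' / 2"
    using bound(1)[OF v(1)] bound(1)[OF v(2)] unfolding abs_less_iff
    by (intro sin_inj_pi[OF _ _ _ _ sin_eq]) linarith+
  then have Im_eq: "Im v = Im v'"
    by simp
  define a where "a = (Re v' - Re v) / N"
  define w where "w = u / u'"
  have nz: "u' \<noteq> 0"
    using u by auto
  have w1: "w ^ p = cis (- real q * a)" and w2: "w ^ q = cis (real p * a)"
  proof -
    have "u ^ p * cis (- real q * Re v / N) = u' ^ p * cis (- real q * Re v' / N)"
      using eq1 sin_pos[OF v(1)] Im_eq by (simp add: mult.assoc)
    then have "w ^ p = cis (- real q * Re v' / N) / cis (- real q * Re v / N)"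
      using nz by (simp add: w_def power_divide frac_eq_eq mult.commute)
    then show "w ^ p = cis (- real q * a)"
      by (simp add: cis_divide a_def right_diff_distrib diff_divide_distrib)
    have "u ^ q * cis (real p * Re v / N) = u' ^ q * cis (real p * Re v' / N)"
      using eq2 cos_pos[OF v(1)] Im_eq by (simp add: mult.assoc)
    then have "w ^ q = cis (real p * Re v' / N) / cis (real p * Re v / N)"
      using nz by (simp add: w_def power_divide frac_eq_eq mult.commute)
    then show "w ^ q = cis (real p * a)"
      by (simp add: cis_divide a_def right_diff_distrib diff_divide_distrib)
  qed
  have "cis (- (real q ^ 2) * a) = (w ^ p) ^ q"
    by (simp add: w1 Complex.DeMoivre power2_eq_square mult_ac)
  also have "\<dots> = (w ^ q) ^ p"
    by (simp add: mult.commute flip: power_mult)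
  also have "\<dots> = cis (real p ^ 2 * a)"
    by (simp add: w2 Complex.DeMoivre power2_eq_square mult_ac)
  finally have "cis (real p ^ 2 * a) / cis (- (real q ^ 2) * a) = 1"
    by simp
  then have "cis (N * a) = 1"
    by (simp add: cis_divide N_def algebra_simps)
  then have "cis (Re v' - Re v) = 1"
    using N by (simp add: a_def)
  then have "cos (Re v' - Re v) = 1"
    by (metis cis.simps(1) one_complex.simps(1))
  moreover have "\<bar>Re v' - Re v\<bar> < 2 * pi"
    using bound(2)[OF v(1)] bound(2)[OF v(2)] pi_gt3 by linarith
  ultimately have Re_eq: "Re v = Re v'"
  proof -
    assume cos: "cos (Re v' - Re v) = 1" and less: "\<bar>Re v' - Re v\<bar> < 2 * pi"
    obtain n :: int where n: "Re v' - Re v = of_int n * (2 * pi)"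
      using cos cos_one_2pi_int[of "Re v' - Re v"] by (auto simp: mult.assoc)
    then have "\<bar>of_int n\<bar> < (1::real)"
      using less by (simp add: abs_mult)
    then have "n = 0"
      by simp
    then show ?thesis
      using n by simp
  qed
  then have "w ^ p = 1" "w ^ q = 1"
    using w1 w2 by (simp_all add: a_def)
  moreover obtain x y where "p * x = q * y + gcd p q"
    using bezout_nat[of p q] assms by blast
  then have "w ^ (p * x) = w ^ (q * y + 1)"
    using assms by (simp only: coprime_iff_gcd_eq_1)
  ultimately have "w = 1"
    by (simp add: power_add power_mult)
  then show "u = u' \<and> v = v'"
    using nz Re_eq Im_eq by (simp add: w_def complex_eqI)
qed

end

theory Submission
  imports Defs "HOL-Complex_Analysis.Winding_Numbers" "HOL-Algebra.Multiplicative_Group"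
begin

text \<open>
  Let \<open>h = \<mu>\<^sup>p\<^sup>q \<lambda>\<close> be the class of a regular fibre of the Seifert fibration of the exterior. It is central
  and has linking number \<open>pq\<close> with the knot, and the slope \<open>m/n\<close> is represented by \<open>\<mu>\<^sup>d h\<^sup>n\<close> with
  \<open>d = m - pqn\<close>. If the normal closure for \<open>m/n\<close> is contained in that for \<open>m'/n'\<close>, then linking numbers
  give \<open>m' dvd m\<close>. Moreover \<open>d' dvd d\<close>, because the group modulo \<open>h\<close> and \<open>\<mu>\<^sup>d\<^sup>'\<close> is the triangle group
  \<open>(p, q, d')\<close>, in which \<open>\<mu>\<close> has order \<open>\<bar>d'\<bar>\<close>. Hence only finitely many slopes lie above a given one
  with \<open>m\<close> and \<open>d\<close> nonzero, which proves (i).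

  For (ii), \<open>h\<close> has finite order modulo \<open>\<mu>\<^sup>d h\<^sup>n\<close>, say \<open>M\<close>. Then \<open>\<mu>\<^sup>d h\<^sup>n\<^sup>'\<close> with \<open>n' = n + \<bar>d\<bar> M\<close> lies in the
  normal closure of \<open>\<mu>\<^sup>d h\<^sup>n\<close>, and counting exponents shows that \<open>h\<close> has finite order modulo \<open>\<mu>\<^sup>d h\<^sup>n\<^sup>'\<close>
  again, so that the step can be repeated.

  The order of \<open>\<mu>\<close> is detected by representations in \<open>GL\<^sub>2\<close> that kill \<open>h\<close>. They are the holonomy of flat
  bundles on the exterior, glued from the two solid tori into which it is cut, so that no
  presentation of the knot group is needed.
\<close>

section \<open>Slopes in a group with a central fibre\<close>

text \<open>The divisibility for d needs quotients in which \<open>h\<close> dies and \<mu> has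
  order exactly |d'|. There every slope element with first exponent d' dies, whatever its power of
  \<open>h\<close>. If m or d is zero, divisibility says nothing, but coprimality then leaves only
  the slopes 0 and pq, so an injective chain must leave them. In (ii), finiteness of the surgery
  group serves only at the start: it makes \<open>h\<close> torsion and excludes d = 0, since a
  power of \<open>h\<close> dies in all those quotients and \<mu> would keep infinite order. Along
  the chain only the torsion of \<open>h\<close> is carried. It survives a change of n to n' because
  linking numbers turn the exponent count e into \<open>P * M = e * (d + P * n')\<close>. For the
  representations, the obstacle is that principal arguments jump. The charts are therefore allowed
  to be discontinuous; only their quotients must be locally constant. Linking numbers come from a
  function as well: after rescaling the coordinates, z^q - w^p vanishes on the sphere exactly along
  the knot, and its winding number along a loop is additive. The same number singles out the
  preferred longitude.\<close>

lemma (in group) normal_closure: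
  assumes "A \<subseteq> carrier G"
  shows "normal_closure G A \<lhd> G" "A \<subseteq> normal_closure G A"
proof -
  have "carrier G \<lhd> G"
    by (rule normal_invI[OF subgroup_self]) auto
  then have ne: "{N. N \<lhd> G \<and> A \<subseteq> N} \<noteq> {}"
    using assms by blast
  have "subgroup (normal_closure G A) G"
    unfolding normal_closure_def using ne
    by (rule subgroups_Inter[rotated]) (auto intro: normal_imp_subgroup)
  then show "normal_closure G A \<lhd> G"
    by (rule normal_invI) (auto simp: normal_closure_def intro: normal.inv_op_closed2)
  show "A \<subseteq> normal_closure G A"
    by (auto simp: normal_closure_def)
qed

lemma normal_closure_subset: "N \<lhd> G \<Longrightarrow> A \<subseteq> N \<Longrightarrow> normal_closure G A \<subseteq> N"
  by (auto simp: normal_closure_def)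

lemma (in group) subgroup_int_pow_closed:
  assumes "subgroup N G" "x \<in> N"
  shows "x [^] (k::int) \<in> N"
proof -
  have nat: "x [^] (n::nat) \<in> N" for n
    by (induction n) (use assms in \<open>auto intro: subgroup.one_closed subgroup.m_closed\<close>)
  show ?thesis
    using nat assms subgroup.m_inv_closed unfolding int_pow_def2 by metis
qed

text \<open>Everything the chain arguments need to know about the knot. For a torus knot
  \<open>P\<close> is pq, and \<open>order_quotient\<close> comes from the triangle group (p, q, d).
  The range \<open>d \<ge> 2\<close> is enough: smaller |d| is bounded anyway in the ascending case,
  and the descending case uses a modulus k + 1 with k > 0.\<close>

locale slope_group = group G for G (structure) +
  fixes \<mu> h :: 'a and lk :: "'a \<Rightarrow> int" and P :: int
  assumes \<mu>_closed [simp]: "\<mu> \<in> carrier G" and h_closed [simp]: "h \<in> carrier G"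
    and h_central: "\<And>g. g \<in> carrier G \<Longrightarrow> h \<otimes> g = g \<otimes> h"
    and lk_mult: "\<And>g g'. g \<in> carrier G \<Longrightarrow> g' \<in> carrier G \<Longrightarrow> lk (g \<otimes> g') = lk g + lk g'"
    and lk_\<mu>: "lk \<mu> = 1" and lk_h: "lk h = P" and P_pos: "P > 0"
    and order_quotient: "\<And>d::int. d \<ge> 2 \<Longrightarrow>
      \<exists>N. N \<lhd> G \<and> h \<in> N \<and> \<mu> [^] d \<in> N \<and> (\<forall>k::int. \<mu> [^] k \<in> N \<longrightarrow> d dvd k)"
begin

definition W :: "int \<Rightarrow> int \<Rightarrow> 'a set" where
  "W d n = normal_closure G {\<mu> [^] d \<otimes> h [^] n}"

lemma W_normal: "W d n \<lhd> G" and W_mem: "\<mu> [^] d \<otimes> h [^] n \<in> W d n"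
  unfolding W_def using normal_closure[of "{\<mu> [^] d \<otimes> h [^] n}"] by auto

lemma W_subset: "N \<lhd> G \<Longrightarrow> \<mu> [^] d \<otimes> h [^] n \<in> N \<Longrightarrow> W d n \<subseteq> N"
  unfolding W_def by (rule normal_closure_subset) auto

lemma W_subgroup: "subgroup (W d n) G"
  using W_normal normal_imp_subgroup by blast

lemma h_pow_central: "g \<in> carrier G \<Longrightarrow> h [^] (k::int) \<otimes> g = g \<otimes> h [^] k"
proof -
  assume g: "g \<in> carrier G"
  have nat: "h [^] (n::nat) \<otimes> g = g \<otimes> h [^] n" for n
    using group_commutes_pow h_central g by simp
  have "inv (h [^] (n::nat)) \<otimes> g = g \<otimes> inv (h [^] n)" for n
    using nat[of n] g by (metis h_closed inv_closed inv_solve_left inv_solve_right m_assoc m_closed nat_pow_closed)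
  with nat show ?thesis
    using g by (cases k rule: int_cases3) (simp_all add: int_pow_neg int_pow_int)
qed

lemma lk_one: "lk \<one> = 0"
  using lk_mult[of \<one> \<one>] by simp

lemma lk_inv: "g \<in> carrier G \<Longrightarrow> lk (inv g) = - lk g"
  using lk_mult[of g "inv g"] lk_one by simp

lemma lk_pow: "g \<in> carrier G \<Longrightarrow> lk (g [^] (k::int)) = k * lk g"
proof -
  assume g: "g \<in> carrier G"
  have nat: "lk (g [^] (n::nat)) = int n * lk g" for n
    by (induction n) (auto simp: g lk_one lk_mult algebra_simps)
  show ?thesis
    by (cases k rule: int_cases3) (simp_all add: int_pow_neg int_pow_int nat lk_inv lk_one g)
qed

lemma lk_slope: "lk (\<mu> [^] d \<otimes> h [^] n) = d + P * n"
  by (simp add: lk_mult lk_pow lk_\<mu> lk_h)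

lemma lk_W_dvd:
  assumes "g \<in> W d n"
  shows "(d + P * n) dvd lk g"
proof -
  have "{g \<in> carrier G. (d + P * n) dvd lk g} \<lhd> G"
    by (intro normal_invI subgroupI) (auto simp: lk_mult lk_inv lk_one intro!: exI[of _ \<one>])
  then have "W d n \<subseteq> {g \<in> carrier G. (d + P * n) dvd lk g}"
    by (rule W_subset) (simp add: lk_slope)
  with assms show ?thesis
    by blast
qed

text \<open>In the quotient for |d'| both \<open>h\<close> and \<mu>^d' die, hence all of
  \<open>W d' n'\<close>. So \<mu>^d h^n dies, and with it \<mu>^d, whose exponent must then be a
  multiple of the order of \<mu>.\<close>

lemma W_subset_dvd:
  assumes sub: "W d n \<subseteq> W d' n'" and d': "\<bar>d'\<bar> \<ge> 2"
  shows "d' dvd d"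
proof -
  obtain N where N: "N \<lhd> G" "h \<in> N" "\<mu> [^] \<bar>d'\<bar> \<in> N"
    and dvd: "\<And>k::int. \<mu> [^] k \<in> N \<Longrightarrow> \<bar>d'\<bar> dvd k"
    using order_quotient[OF d'] by blast
  have sg: "subgroup N G"
    using N(1) by (rule normal_imp_subgroup)
  have "\<mu> [^] d' = (\<mu> [^] \<bar>d'\<bar>) [^] sgn d'"
    by (simp add: int_pow_pow abs_mult_sgn)
  then have "\<mu> [^] d' \<in> N"
    using subgroup_int_pow_closed[OF sg N(3)] by simp
  then have "W d' n' \<subseteq> N"
    using N(2) sg W_subset[OF N(1)] subgroup.m_closed subgroup_int_pow_closed by metis
  then have "\<mu> [^] d \<otimes> h [^] n \<in> N"
    using sub W_mem by blast
  then have "\<mu> [^] d \<otimes> h [^] n \<otimes> h [^] (- n) \<in> N"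
    using subgroup.m_closed[OF sg] subgroup_int_pow_closed[OF sg N(2)] by blast
  then have "\<mu> [^] d \<in> N"
    by (simp add: m_assoc flip: int_pow_mult)
  then show ?thesis
    using dvd by simp
qed

text \<open>Each element of \<open>W d n\<close> has an exponent sum \<open>e\<close> in the conjugates of the generator, and
  replacing \<open>n\<close> by \<open>n'\<close> in the generator multiplies it by \<open>h\<^sup>(\<^sup>n\<^sup>'\<^sup>-\<^sup>n\<^sup>)\<^sup>e\<close>.\<close>

lemma W_exponent_sum:
  assumes "g \<in> W d n"
  shows "\<exists>e. lk g = e * (d + P * n) \<and> g \<otimes> h [^] ((n' - n) * e) \<in> W d n'"
proof -
  interpret W': normal "W d n'" G
    by (rule W_normal)
  \<comment> \<open>The exponent is existentially quantified inside the set, so no exponent map on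
    the normal closure has to be shown well defined; it is enough that \<open>S\<close> is normal
    and contains the generator.\<close>
  define S where
    "S = {g \<in> carrier G. \<exists>e. lk g = e * (d + P * n) \<and> g \<otimes> h [^] ((n' - n) * e) \<in> W d n'}"
  have "subgroup S G"
  proof (rule subgroupI)
    show "S \<subseteq> carrier G"
      by (auto simp: S_def)
    have "\<one> \<in> S"
      unfolding S_def using W'.one_closed by (auto simp: lk_one intro!: exI[of _ 0])
    then show "S \<noteq> {}"
      by blast
    fix a assume "a \<in> S"
    then obtain e where a: "a \<in> carrier G" "lk a = e * (d + P * n)"
      "a \<otimes> h [^] ((n' - n) * e) \<in> W d n'"
      by (auto simp: S_def)
    have "inv (a \<otimes> h [^] ((n' - n) * e)) = inv a \<otimes> h [^] ((n' - n) * (- e))"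
      using a(1) h_pow_central[of "inv a"] by (simp add: inv_mult_group flip: int_pow_neg)
    moreover have "inv (a \<otimes> h [^] ((n' - n) * e)) \<in> W d n'"
      using a(3) by (rule W'.m_inv_closed)
    ultimately show "inv a \<in> S"
      using a by (auto simp: S_def lk_inv intro!: exI[of _ "- e"])
    fix b assume "b \<in> S"
    then obtain e' where b: "b \<in> carrier G" "lk b = e' * (d + P * n)"
      "b \<otimes> h [^] ((n' - n) * e') \<in> W d n'"
      by (auto simp: S_def)
    have "(a \<otimes> h [^] ((n' - n) * e)) \<otimes> (b \<otimes> h [^] ((n' - n) * e'))
        = a \<otimes> (h [^] ((n' - n) * e) \<otimes> b) \<otimes> h [^] ((n' - n) * e')"
      using a(1) b(1) by (simp add: m_assoc)
    also have "\<dots> = (a \<otimes> b) \<otimes> (h [^] ((n' - n) * e) \<otimes> h [^] ((n' - n) * e'))"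
      using a(1) b(1) by (simp add: h_pow_central[OF b(1)] m_assoc)
    also have "\<dots> = (a \<otimes> b) \<otimes> h [^] ((n' - n) * (e + e'))"
      by (simp add: distrib_left flip: int_pow_mult)
    finally show "a \<otimes> b \<in> S"
      using a b W'.m_closed[OF a(3) b(3)]
      by (auto simp: S_def lk_mult distrib_right intro!: exI[of _ "e + e'"])
  qed
  then have "S \<lhd> G"
  proof (rule normal_invI)
    fix x g assume x: "x \<in> carrier G" and "g \<in> S"
    then obtain e where g: "g \<in> carrier G" "lk g = e * (d + P * n)"
      "g \<otimes> h [^] ((n' - n) * e) \<in> W d n'"
      by (auto simp: S_def)
    have "x \<otimes> (g \<otimes> h [^] ((n' - n) * e)) \<otimes> inv x = x \<otimes> g \<otimes> (h [^] ((n' - n) * e) \<otimes> inv x)"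
      using x g(1) by (simp add: m_assoc)
    also have "\<dots> = x \<otimes> g \<otimes> inv x \<otimes> h [^] ((n' - n) * e)"
      using x g(1) by (simp add: m_assoc h_pow_central[of "inv x"])
    finally show "x \<otimes> g \<otimes> inv x \<in> S"
      using x g W'.inv_op_closed2[OF x g(3)]
      by (auto simp: S_def lk_mult lk_inv intro!: exI[of _ e])
  qed
  moreover have "\<mu> [^] d \<otimes> h [^] n \<in> S"
  proof -
    have "\<mu> [^] d \<otimes> h [^] n \<otimes> h [^] ((n' - n) * 1) = \<mu> [^] d \<otimes> h [^] n'"
      by (simp add: m_assoc flip: int_pow_mult)
    then show ?thesis
      using W_mem[of d n'] by (auto simp: S_def lk_slope intro!: exI[of _ 1])
  qed
  ultimately have "W d n \<subseteq> S"
    by (rule W_subset)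
  then show ?thesis
    using assms by (auto simp: S_def)
qed

text \<open>The exponent count e of \<open>h [^] N\<close> satisfies P N = e (d + P n), so e is
  nonzero. Moving to n' changes the exponent of \<open>h\<close> to M with P M = e (d + P n'), which
  is again nonzero, and its sign can be flipped.\<close>

lemma torsion_transfer:
  assumes "h [^] (N::int) \<in> W d n" "N \<noteq> 0" "d + P * n' \<noteq> 0"
  shows "\<exists>M::int. M > 0 \<and> h [^] M \<in> W d n'"
proof -
  obtain e where e: "lk (h [^] N) = e * (d + P * n)"
    "h [^] N \<otimes> h [^] ((n' - n) * e) \<in> W d n'"
    using W_exponent_sum[OF assms(1)] by blast
  define M where "M = N + (n' - n) * e"
  have M: "h [^] M \<in> W d n'"
    using e(2) by (simp add: M_def int_pow_mult)
  have "P * N = e * (d + P * n)"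
    using e(1) by (simp add: lk_pow lk_h mult.commute)
  then have PM: "P * M = e * (d + P * n')"
    by (simp add: M_def algebra_simps)
  have "e \<noteq> 0"
    using \<open>P * N = e * (d + P * n)\<close> assms(2) P_pos by auto
  then have "M \<noteq> 0"
    using PM assms(3) by auto
  moreover have "h [^] (- M) \<in> W d n'"
    using subgroup.m_inv_closed[OF W_subgroup M] by (simp add: int_pow_neg)
  ultimately show ?thesis
    using M by (cases "M > 0") (auto intro: exI[of _ M] exI[of _ "- M"])
qed

text \<open>The exponents (d, n) of the slope element in terms of \<mu> and \<open>h\<close>. Here
  |d| is the distance of the slope from the fibre slope \<open>P\<close>, and
  \<open>d + P * n\<close> recovers the numerator m.\<close>

fun coords :: "slope \<Rightarrow> int \<times> int" where
  "coords (Rational r) = (fst (quotient_of r) - P * snd (quotient_of r), snd (quotient_of r))"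
| "coords Infinity = (1, 0)"

lemma inj_coords: "inj coords"
proof (rule injI)
  fix x y assume eq: "coords x = coords y"
  have pos: "snd (quotient_of r) \<noteq> 0" for r
    using quotient_of_denom_pos'[of r] by simp
  show "x = y"
  proof (cases x; cases y)
    fix r r' assume xy: "x = Rational r" "y = Rational r'"
    then have "quotient_of r = quotient_of r'"
      using eq by (auto intro: prod_eqI)
    then show "x = y"
      using xy quotient_of_inject by blast
  qed (use eq pos in auto)
qed

lemma coords_coprime: "coprime (fst (coords s)) (snd (coords s))"
proof (cases s)
  case (Rational r)
  have "coprime (fst (quotient_of r)) (snd (quotient_of r))"
    using quotient_of_coprime[of r] by (simp add: prod_eq_iff)
  then have "coprime (- P * snd (quotient_of r) + fst (quotient_of r)) (snd (quotient_of r))"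
    by (metis coprime_iff_gcd_eq_1 gcd.commute gcd_add_mult)
  then show ?thesis
    by (simp add: Rational)
qed simp

lemma coords_eqI:
  assumes "coprime d n" "n > 0"
  shows "coords (Rational (Fract (d + P * n) n)) = (d, n)"
proof -
  have "coprime (P * n + d) n"
    using assms(1) by (metis coprime_iff_gcd_eq_1 gcd.commute gcd_add_mult)
  then have "quotient_of (Fract (d + P * n) n) = (d + P * n, n)"
    using assms(2) by (simp add: quotient_of_Fract normalize_stable add.commute)
  then show ?thesis
    by simp
qed

section \<open>The two chain arguments, with the longitude expressed through the fibre\<close>

context
  fixes l assumes l: "l = h \<otimes> \<mu> [^] (- P)"
begin

lemma slope_closure_eq_W:
  "slope_closure G \<mu> l s = W (fst (coords s)) (snd (coords s))"
proof (cases s)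
  case (Rational r)
  obtain m n where q: "quotient_of r = (m, n)"
    by force
  have "l [^] n = h [^] n \<otimes> (\<mu> [^] (- P)) [^] n"
    unfolding l by (rule int_pow_mult_distrib) (auto simp: h_central)
  then have "\<mu> [^] m \<otimes> l [^] n = \<mu> [^] m \<otimes> (\<mu> [^] (- P * n) \<otimes> h [^] n)"
    using h_pow_central[of "\<mu> [^] (- P * n)" n] by (simp add: int_pow_pow)
  also have "\<dots> = \<mu> [^] (m - P * n) \<otimes> h [^] n"
    by (simp flip: m_assoc int_pow_mult)
  finally show ?thesis
    by (simp add: Rational q slope_closure_def W_def)
qed (simp add: slope_closure_def W_def)

lemma no_ascending_chain:
  assumes inj: "inj r"
    and chain: "\<And>i::nat. slope_closure G \<mu> l (r i) \<subseteq> slope_closure G \<mu> l (r (Suc i))"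
  shows False
proof -
  define d n where "d i = fst (coords (r i))" and "n i = snd (coords (r i))" for i
  have W: "slope_closure G \<mu> l (r i) = W (d i) (n i)" for i
    by (simp add: slope_closure_eq_W d_def n_def)
  have inj_dn: "inj (\<lambda>i. (d i, n i))"
    using inj_compose[OF inj_coords inj] by (simp add: d_def n_def comp_def)
  have mono: "W (d i) (n i) \<subseteq> W (d j) (n j)" if "i \<le> j" for i j
    using lift_Suc_mono_le[of "\<lambda>i. W (d i) (n i)"] chain that by (simp add: W)
  have cop: "coprime (d i) (n i)" for i
    using coords_coprime by (simp add: d_def n_def)
  have npos: "n i \<ge> 0" for i
    using quotient_of_denom_pos' by (cases "r i") (auto simp: n_def less_imp_le)
  have d0: "n i = 1" if "d i = 0" for i
    using cop[of i] npos[of i] that by simp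
  have m0: "n i = 1" if "d i + P * n i = 0" for i
  proof -
    have "d i = n i * (- P)"
      using that by (simp add: algebra_simps)
    then have "n i dvd d i"
      by (metis dvd_triv_left)
    then have "is_unit (n i)"
      using cop[of i] by (metis coprime_def dvd_refl)
    then show ?thesis
      using npos[of i] by simp
  qed
  have unique: "i = j" if "d i = d j" "n i = n j" for i j
    using inj_dn that by (auto simp: inj_def)
  \<comment> \<open>By \<open>d0\<close> and \<open>m0\<close> the exceptional coordinates are (0,
    1) and (- P, 1) only, that is the slopes \<open>P\<close> and 0; an injective sequence cannot
    stay among them.\<close>
  have "\<exists>i. d i \<noteq> 0 \<and> d i + P * n i \<noteq> 0"
  proof (rule ccontr)
    assume "\<nexists>i. d i \<noteq> 0 \<and> d i + P * n i \<noteq> 0"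
    then have "d i \<in> {0, - P} \<and> n i = 1" for i
      using d0[of i] m0[of i] by force
    then have "range (\<lambda>i. (d i, n i)) \<subseteq> {0, - P} \<times> {1}"
      by auto
    then have "finite (range (\<lambda>i. (d i, n i)))"
      by (rule finite_subset) auto
    then show False
      using inj_dn finite_imageD by blast
  qed
  then obtain i where i: "d i \<noteq> 0" "d i + P * n i \<noteq> 0"
    by blast
  have bounds: "\<bar>d j\<bar> \<le> \<bar>d i\<bar> \<and> \<bar>d j + P * n j\<bar> \<le> \<bar>d i + P * n i\<bar>" if "j \<ge> i" for j
  proof
    show "\<bar>d j\<bar> \<le> \<bar>d i\<bar>"
    \<comment> \<open>For |d j| at most 1 no quotient is available, but the bound then follows from
      d i being nonzero.\<close>
    proof (cases "\<bar>d j\<bar> \<ge> 2")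
      case True
      then have "d j dvd d i"
        using W_subset_dvd[OF mono[OF that]] by blast
      then show ?thesis
        using i(1) by (rule dvd_imp_le_int[rotated])
    qed (use i(1) in linarith)
    have "(d j + P * n j) dvd (d i + P * n i)"
      using lk_W_dvd W_mem[of "d i" "n i"] mono[OF that] lk_slope by (metis subsetD)
    then show "\<bar>d j + P * n j\<bar> \<le> \<bar>d i + P * n i\<bar>"
      using i(2) by (rule dvd_imp_le_int[rotated])
  qed
  \<comment> \<open>The pair (d, m) still determines the slope because \<open>P\<close> is nonzero,
    so a finite box of such pairs catches the whole tail of the chain.\<close>
  define B where "B = {- \<bar>d i\<bar>..\<bar>d i\<bar>} \<times> {- \<bar>d i + P * n i\<bar>..\<bar>d i + P * n i\<bar>}"
  have "(\<lambda>j. (d j, d j + P * n j)) ` {i..} \<subseteq> B"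
    using bounds by (fastforce simp: B_def abs_le_iff)
  then have "finite ((\<lambda>j. (d j, d j + P * n j)) ` {i..})"
    by (rule finite_subset) (simp add: B_def)
  moreover have "inj_on (\<lambda>j. (d j, d j + P * n j)) {i..}"
    using unique P_pos by (auto simp: inj_on_def)
  ultimately have "finite {i..}"
    using finite_imageD by blast
  then show False
    using infinite_Ici by blast
qed

lemma descending_chain:
  assumes fin: "finite (carrier (G Mod slope_closure G \<mu> l (Rational r)))"
  shows "\<exists>s::nat \<Rightarrow> slope. inj s \<and> s 0 = Rational r \<and>
    (\<forall>i. slope_closure G \<mu> l (s (Suc i)) \<subseteq> slope_closure G \<mu> l (s i))"
proof -
  define d n where "d = fst (coords (Rational r))" and "n = snd (coords (Rational r))"
  have cop: "coprime d n"
    unfolding d_def n_def by (rule coords_coprime)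
  have n: "n > 0"
    using quotient_of_denom_pos' by (simp add: n_def)
  have torsion: "\<exists>N::int. N > 0 \<and> x [^] N \<in> W d n" if x: "x \<in> carrier G" for x
  proof -
    interpret N: normal "W d n" G
      by (rule W_normal)
    interpret Q: group "G Mod W d n"
      by (rule N.factorgroup_is_group)
    have fin': "finite (carrier (G Mod W d n))"
      using fin by (simp add: slope_closure_eq_W d_def n_def)
    define N where "N = Coset.order (G Mod W d n)"
    have N: "N > 0"
      using fin' Q.order_gt_0_iff_finite by (simp add: N_def)
    have "(W d n #> x) [^]\<^bsub>G Mod W d n\<^esub> N = \<one>\<^bsub>G Mod W d n\<^esub>"
      unfolding N_def by (rule Q.pow_order_eq_1) (auto simp: FactGroup_def RCOSETS_def x)
    moreover have "(W d n #> x) [^]\<^bsub>G Mod W d n\<^esub> k = W d n #> (x [^] k)" for k :: nat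
      by (induction k) (auto simp: x N.rcos_sum FactGroup_def coset_mult_one N.subset)
    ultimately have "W d n #> (x [^] N) = W d n"
      by (simp add: FactGroup_def)
    then have "x [^] N \<in> W d n"
      using x rcos_self[OF _ W_subgroup, of "x [^] N" d n] by simp
    then show ?thesis
      using N by (intro exI[of _ "int N"]) (simp add: int_pow_int)
  qed
  have "d \<noteq> 0"
  proof
    assume d: "d = 0"
    obtain k :: int where k: "k > 0" "\<mu> [^] k \<in> W d n"
      using torsion[of \<mu>] by auto
    \<comment> \<open>For d = 0 the generator is a power of \<open>h\<close> and dies in every order
      quotient. The modulus k + 1 is at least 2 and does not divide k, against \<mu>^k being
      trivial.\<close>
    obtain N where N: "N \<lhd> G" "h \<in> N" and dvd: "\<And>j::int. \<mu> [^] j \<in> N \<Longrightarrow> (k + 1) dvd j"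
      using order_quotient[of "k + 1"] k by auto
    have "W d n \<subseteq> N"
      using N d normal_imp_subgroup by (intro W_subset) (auto intro: subgroup_int_pow_closed)
    then have "(k + 1) dvd k"
      using k dvd by blast
    then show False
      using k zdvd_imp_le by fastforce
  qed
  \<comment> \<open>The factor |d| keeps the new denominator coprime to d, so that the new pair is
    again a slope.\<close>
  define step where "step n' = n' + \<bar>d\<bar> * (SOME M. M > 0 \<and> h [^] M \<in> W d n')" for n' :: int
  define good where "good n' \<longleftrightarrow> n' > 0 \<and> coprime d n' \<and> (\<exists>M>0. h [^] (M::int) \<in> W d n')"
    for n' :: int
  have step: "good (step n') \<and> step n' > n' \<and> W d (step n') \<subseteq> W d n'" if "good n'" for n'
  proof -
    define M where "M = (SOME M. M > 0 \<and> h [^] (M::int) \<in> W d n')"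
    have M: "M > 0" "h [^] M \<in> W d n'"
      using someI_ex[of "\<lambda>M. M > 0 \<and> h [^] (M::int) \<in> W d n'"] that
      unfolding M_def good_def by blast+
    have eq: "step n' = n' + \<bar>d\<bar> * M"
      by (simp add: step_def M_def)
    have pos: "\<bar>d\<bar> * M > 0"
      using M \<open>d \<noteq> 0\<close> by simp
    \<comment> \<open>The new denominator exceeds |d|, so its product with \<open>P\<close> cannot
      cancel d; this is the nonvanishing that \<open>torsion_transfer\<close> asks for.\<close>
    have "\<bar>d\<bar> * 1 \<le> \<bar>d\<bar> * M"
      using M by (intro mult_left_mono) auto
    then have "step n' > \<bar>d\<bar>"
      using that eq by (simp add: good_def)
    moreover have "P * step n' \<ge> 1 * step n'"
      using P_pos pos that eq by (intro mult_right_mono) (auto simp: good_def)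
    ultimately have "d + P * step n' \<noteq> 0"
      by linarith
    then have tors: "\<exists>M>0. h [^] (M::int) \<in> W d (step n')"
      using torsion_transfer[OF M(2)] M(1) by auto
    have "coprime d (step n')"
    proof -
      have "step n' = n' + d * (sgn d * M)"
        unfolding eq by (simp add: abs_sgn mult.assoc)
      moreover have "gcd d ((sgn d * M) * d + n') = gcd d n'"
        by (rule gcd_add_mult)
      ultimately show ?thesis
        using that unfolding good_def coprime_iff_gcd_eq_1 by (simp add: algebra_simps)
    qed
    moreover have "W d (step n') \<subseteq> W d n'"
    proof (rule W_subset[OF W_normal])
      have "\<mu> [^] d \<otimes> h [^] step n' = (\<mu> [^] d \<otimes> h [^] n') \<otimes> (h [^] M) [^] \<bar>d\<bar>"
        by (simp add: eq int_pow_mult int_pow_pow m_assoc mult.commute)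
      also have "\<dots> \<in> W d n'"
        by (rule subgroup.m_closed[OF W_subgroup W_mem
              subgroup_int_pow_closed[OF W_subgroup M(2)]])
      finally show "\<mu> [^] d \<otimes> h [^] step n' \<in> W d n'" .
    qed
    ultimately show ?thesis
      using tors that pos eq by (simp add: good_def)
  qed
  define N where "N i = (step ^^ i) n" for i
  have good: "good (N i)" for i
  proof (induction i)
    case 0
    then show ?case
      using n cop torsion[of h] by (simp add: good_def N_def)
  qed (use step in \<open>simp add: N_def\<close>)
  define s where "s i = Rational (Fract (d + P * N i) (N i))" for i
  have coords_s: "coords (s i) = (d, N i)" for i
    unfolding s_def using good[of i] by (intro coords_eqI) (auto simp: good_def)
  have "strict_mono N"
    unfolding strict_mono_Suc_iff using step good by (simp add: N_def)
  then have "inj s"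
    using coords_s by (metis injI prod.inject strict_mono_eq)
  moreover have "s 0 = Rational r"
  proof -
    have "coords (s 0) = coords (Rational r)"
      unfolding coords_s by (simp add: N_def d_def n_def)
    then show ?thesis
      using inj_coords by (simp add: inj_def)
  qed
  moreover have "slope_closure G \<mu> l (s (Suc i)) \<subseteq> slope_closure G \<mu> l (s i)" for i
    using step[OF good[of i]] by (simp add: slope_closure_eq_W coords_s N_def)
  ultimately show ?thesis
    by blast
qed

end

end


section \<open>Holonomy of flat bundles\<close>

lemma continuous_on_eventually_nhds:
  assumes "continuous_on S f" "a \<in> S" "\<forall>\<^sub>F y in nhds (f a). P y"
  shows "\<forall>\<^sub>F x in nhds a. x \<in> S \<longrightarrow> P (f x)"
proof -
  have "(f \<longlongrightarrow> f a) (at a within S)"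
    using assms continuous_on_def by blast
  then have "\<forall>\<^sub>F x in at a within S. P (f x)"
    using assms(3) eventually_compose_filterlim by blast
  then show ?thesis
    unfolding eventually_at_filter
    by (rule eventually_mono) (use assms(3) eventually_nhds_x_imp_x in blast)
qed

text \<open>
  A flat atlas describes a flat principal \<open>H\<close>-bundle over \<open>X\<close> by one reference trivialisation at each
  point, which may be discontinuous, and local flat sections (the charts) expressed in it.
\<close>

locale flat_atlas = group H for H (structure) +
  fixes X :: "'x::real_normed_vector set"
    and I :: "'i set"
    and domain :: "'i \<Rightarrow> 'x set"
    and chart :: "'i \<Rightarrow> 'x \<Rightarrow> 'a"
  assumes open_domain: "\<And>i. i \<in> I \<Longrightarrow> openin (top_of_set X) (domain i)"
    and cover: "\<And>x. x \<in> X \<Longrightarrow> \<exists>i\<in>I. x \<in> domain i"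
    and chart_closed: "\<And>i x. i \<in> I \<Longrightarrow> x \<in> X \<Longrightarrow> chart i x \<in> carrier H"
    and compatible: "\<And>i j x. i \<in> I \<Longrightarrow> j \<in> I \<Longrightarrow> x \<in> domain i \<Longrightarrow> x \<in> domain j \<Longrightarrow>
      \<forall>\<^sub>F y in nhds x. y \<in> X \<longrightarrow>
        chart i y \<otimes> inv chart j y = chart i x \<otimes> inv chart j x"
begin

text \<open>A parallel section along \<open>K\<close>: near each parameter, \<open>F\<close> is a
  constant left multiple of a chart. No continuity of \<open>F\<close> is asked for, since the
  reference trivialisation may jump. The parameter set is arbitrary so that paths and squares are
  treated alike.\<close>

definition horizontal :: "'q::metric_space set \<Rightarrow> ('q \<Rightarrow> 'x) \<Rightarrow> ('q \<Rightarrow> 'a) \<Rightarrow> bool" where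
  "horizontal S K F \<longleftrightarrow> continuous_on S K \<and> K ` S \<subseteq> X \<and> F ` S \<subseteq> carrier H \<and>
     (\<forall>s\<in>S. \<exists>i\<in>I. K s \<in> domain i \<and>
        (\<forall>\<^sub>F t in nhds s. t \<in> S \<longrightarrow> F t \<otimes> inv chart i (K t) = F s \<otimes> inv chart i (K s)))"

lemma horizontalD:
  assumes "horizontal S K F"
  shows "continuous_on S K" "s \<in> S \<Longrightarrow> K s \<in> X" "s \<in> S \<Longrightarrow> F s \<in> carrier H"
  using assms unfolding horizontal_def by blast+

lemma horizontalE:
  assumes "horizontal S K F" "s \<in> S"
  obtains i where "i \<in> I" "K s \<in> domain i"
    "\<forall>\<^sub>F t in nhds s. t \<in> S \<longrightarrow> F t \<otimes> inv chart i (K t) = F s \<otimes> inv chart i (K s)"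
  using assms unfolding horizontal_def by (elim conjE ballE bexE) auto

text \<open>The definition supplies one chart at each parameter; \<open>compatible\<close> transfers
  local constancy to any other chart there.\<close>

lemma horizontal_chart:
  assumes hor: "horizontal S K F" and s: "s \<in> S" and j: "j \<in> I" "K s \<in> domain j"
  shows "\<forall>\<^sub>F t in nhds s. t \<in> S \<longrightarrow> F t \<otimes> inv chart j (K t) = F s \<otimes> inv chart j (K s)"
proof -
  have K: "continuous_on S K" "\<And>t. t \<in> S \<Longrightarrow> K t \<in> X" and F: "\<And>t. t \<in> S \<Longrightarrow> F t \<in> carrier H"
    using hor by (auto simp: horizontal_def)
  obtain i where i: "i \<in> I" "K s \<in> domain i"
    and ev: "\<forall>\<^sub>F t in nhds s. t \<in> S \<longrightarrow> F t \<otimes> inv chart i (K t) = F s \<otimes> inv chart i (K s)"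
    by (rule horizontalE[OF hor s])
  have "\<forall>\<^sub>F t in nhds s. t \<in> S \<longrightarrow> (K t \<in> X \<longrightarrow>
      chart i (K t) \<otimes> inv chart j (K t) = chart i (K s) \<otimes> inv chart j (K s))"
    by (rule continuous_on_eventually_nhds[OF K(1) s compatible[OF i(1) j(1) i(2) j(2)]])
  then show ?thesis
    using ev
  proof (eventually_elim, intro impI)
    fix t assume t: "t \<in> S"
      and 1: "t \<in> S \<longrightarrow> (K t \<in> X \<longrightarrow>
        chart i (K t) \<otimes> inv chart j (K t) = chart i (K s) \<otimes> inv chart j (K s))"
      and 2: "t \<in> S \<longrightarrow> F t \<otimes> inv chart i (K t) = F s \<otimes> inv chart i (K s)"
    have eq: "F r \<otimes> inv chart j (K r)
        = (F r \<otimes> inv chart i (K r)) \<otimes> (chart i (K r) \<otimes> inv chart j (K r))" if "r \<in> S" for r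
      using that K F i j chart_closed by (simp add: m_assoc inv_solve_left)
    show "F t \<otimes> inv chart j (K t) = F s \<otimes> inv chart j (K s)"
      using 1 2 t s K(2) by (simp add: eq)
  qed
qed

lemma horizontal_compose:
  assumes "horizontal S K F" "continuous_on S' \<sigma>" "\<sigma> ` S' \<subseteq> S"
  shows "horizontal S' (\<lambda>x. K (\<sigma> x)) (\<lambda>x. F (\<sigma> x))"
  unfolding horizontal_def
proof (intro conjI ballI)
  show "continuous_on S' (\<lambda>x. K (\<sigma> x))"
    using assms by (auto simp: horizontal_def intro: continuous_on_compose2)
  fix s assume s: "s \<in> S'"
  then have "\<sigma> s \<in> S"
    using assms(3) by blast
  from assms(1) this obtain i where i: "i \<in> I" "K (\<sigma> s) \<in> domain i"
    and ev: "\<forall>\<^sub>F t in nhds (\<sigma> s). t \<in> S \<longrightarrow>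
      F t \<otimes> inv chart i (K t) = F (\<sigma> s) \<otimes> inv chart i (K (\<sigma> s))"
    by (rule horizontalE)
  show "\<exists>i\<in>I. K (\<sigma> s) \<in> domain i \<and> (\<forall>\<^sub>F t in nhds s. t \<in> S' \<longrightarrow>
      F (\<sigma> t) \<otimes> inv chart i (K (\<sigma> t)) = F (\<sigma> s) \<otimes> inv chart i (K (\<sigma> s)))"
    using i continuous_on_eventually_nhds[OF assms(2) s ev] assms(3)
    by (intro bexI[of _ i] conjI) (auto simp: image_subset_iff cong: imp_cong)
qed (use assms in \<open>auto simp: horizontal_def\<close>)

lemma horizontal_subset: "horizontal S K F \<Longrightarrow> T \<subseteq> S \<Longrightarrow> horizontal T K F"
  using horizontal_compose[of S K F T "\<lambda>x. x"] by simp

lemma horizontal_cong: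
  assumes "horizontal S K F" "\<And>s. s \<in> S \<Longrightarrow> K s = K' s" "\<And>s. s \<in> S \<Longrightarrow> F s = F' s"
  shows "horizontal S K' F'"
  unfolding horizontal_def
proof (intro conjI ballI)
  show "continuous_on S K'"
    using assms continuous_on_cong by (metis horizontal_def)
  fix s assume s: "s \<in> S"
  from assms(1) this obtain i where i: "i \<in> I" "K s \<in> domain i"
    and ev: "\<forall>\<^sub>F t in nhds s. t \<in> S \<longrightarrow> F t \<otimes> inv chart i (K t) = F s \<otimes> inv chart i (K s)"
    by (rule horizontalE)
  show "\<exists>i\<in>I. K' s \<in> domain i \<and>
      (\<forall>\<^sub>F t in nhds s. t \<in> S \<longrightarrow> F' t \<otimes> inv chart i (K' t) = F' s \<otimes> inv chart i (K' s))"
    using i ev s assms(2,3) by (intro bexI[of _ i] conjI) (simp_all cong: imp_cong)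
qed (use assms in \<open>auto simp: horizontal_def image_subset_iff\<close>)

lemma horizontal_mult_left:
  assumes "horizontal S K F" "g \<in> carrier H"
  shows "horizontal S K (\<lambda>s. g \<otimes> F s)"
  unfolding horizontal_def
proof (intro conjI ballI)
  have F: "F s \<in> carrier H" "K s \<in> X" if "s \<in> S" for s
    using assms that by (auto simp: horizontal_def)
  fix s assume s: "s \<in> S"
  from assms(1) this obtain i where i: "i \<in> I" "K s \<in> domain i"
    and ev: "\<forall>\<^sub>F t in nhds s. t \<in> S \<longrightarrow> F t \<otimes> inv chart i (K t) = F s \<otimes> inv chart i (K s)"
    by (rule horizontalE)
  have "\<forall>\<^sub>F t in nhds s. t \<in> S \<longrightarrow>
      g \<otimes> F t \<otimes> inv chart i (K t) = g \<otimes> F s \<otimes> inv chart i (K s)"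
    using ev by eventually_elim (use s i F assms(2) chart_closed in \<open>simp add: m_assoc\<close>)
  with i show "\<exists>i\<in>I. K s \<in> domain i \<and> (\<forall>\<^sub>F t in nhds s. t \<in> S \<longrightarrow>
      g \<otimes> F t \<otimes> inv chart i (K t) = g \<otimes> F s \<otimes> inv chart i (K s))"
    by blast
qed (use assms in \<open>auto simp: horizontal_def\<close>)

text \<open>Measured in a common chart, both sections are locally constant; the chart cancels in
  \<open>F s \<otimes> inv F' s\<close>, which is therefore locally constant on a connected
  set.\<close>

lemma horizontal_unique:
  assumes "horizontal S K F" "horizontal S K F'" "connected S" "s \<in> S" "t \<in> S"
  shows "F s \<otimes> inv F' s = F t \<otimes> inv F' t"
proof -
  have F: "F s \<in> carrier H" "F' s \<in> carrier H" "K s \<in> X" if "s \<in> S" for s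
    using assms(1,2) that by (auto simp: horizontal_def)
  have "(\<lambda>s. F s \<otimes> inv F' s) constant_on S"
  proof (rule locally_constant_imp_constant[OF assms(3)])
    fix a assume a: "a \<in> S"
    then obtain i where i: "i \<in> I" "K a \<in> domain i"
      using F(3) cover by blast
    have eq: "F r \<otimes> inv F' r = (F r \<otimes> inv chart i (K r)) \<otimes> inv (F' r \<otimes> inv chart i (K r))"
      if "r \<in> S" for r
    proof -
      have c: "F r \<in> carrier H" "F' r \<in> carrier H" "chart i (K r) \<in> carrier H"
        using that F i chart_closed by auto
      then show ?thesis
        by (simp add: inv_mult_group m_assoc inv_solve_left)
    qed
    have "\<forall>\<^sub>F t in nhds a. t \<in> S \<longrightarrow> F t \<otimes> inv F' t = F a \<otimes> inv F' a"
      using horizontal_chart[OF assms(1) a i] horizontal_chart[OF assms(2) a i]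
      by eventually_elim (use a eq in simp)
    then obtain T where "open T" "a \<in> T" "\<forall>t\<in>T. t \<in> S \<longrightarrow> F t \<otimes> inv F' t = F a \<otimes> inv F' a"
      unfolding eventually_nhds by (elim exE conjE)
    with a have "openin (top_of_set S) (S \<inter> T)" "a \<in> S \<inter> T"
      "\<forall>x\<in>S \<inter> T. F x \<otimes> inv F' x = F a \<otimes> inv F' a"
      by (blast intro: openin_open_Int)+
    then show "\<exists>T. openin (top_of_set S) T \<and> a \<in> T \<and> (\<forall>x\<in>T. F x \<otimes> inv F' x = F a \<otimes> inv F' a)"
      by blast
  qed
  then show ?thesis
    using assms(4,5) by (auto simp: constant_on_def)
qed

text \<open>By uniqueness the two sections differ by one constant over the connected overlap; left
  multiplication by it makes the second agree with the first.\<close>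

lemma horizontal_glue:
  assumes "closed S1" "closed S2" "connected (S1 \<inter> S2)" "S1 \<inter> S2 \<noteq> {}"
    and hor: "horizontal S1 K F1" "horizontal S2 K F2"
  shows "\<exists>F. horizontal (S1 \<union> S2) K F"
proof -
  obtain c where c: "c \<in> S1" "c \<in> S2"
    using assms(4) by blast
  have F: "\<And>s. s \<in> S1 \<Longrightarrow> F1 s \<in> carrier H" "\<And>s. s \<in> S2 \<Longrightarrow> F2 s \<in> carrier H"
    using hor by (auto simp: horizontal_def)
  define g where "g = F1 c \<otimes> inv F2 c"
  have g: "g \<in> carrier H"
    using F c by (simp add: g_def)
  define F2' where "F2' = (\<lambda>s. g \<otimes> F2 s)"
  have hor': "horizontal S2 K F2'"
    unfolding F2'_def using hor(2) g by (rule horizontal_mult_left)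
  have agree: "F1 s = F2' s" if "s \<in> S1" "s \<in> S2" for s
  proof -
    have "F1 s \<otimes> inv F2 s = g"
      unfolding g_def
      by (rule horizontal_unique[of "S1 \<inter> S2" K])
        (use that c assms(3) horizontal_subset[OF hor(1)] horizontal_subset[OF hor(2)] in auto)
    then show ?thesis
      using F that by (auto simp: F2'_def m_assoc)
  qed
  define F where "F = (\<lambda>s. if s \<in> S1 then F1 s else F2' s)"
  have 1: "horizontal S1 K F"
    by (rule horizontal_cong[OF hor(1)]) (auto simp: F_def)
  have 2: "horizontal S2 K F"
    by (rule horizontal_cong[OF hor']) (auto simp: F_def agree)
  have "horizontal (S1 \<union> S2) K F"
    unfolding horizontal_def
  proof (intro conjI ballI)
    show "continuous_on (S1 \<union> S2) K"
      using assms(1,2) horizontalD(1)[OF hor(1)] horizontalD(1)[OF hor(2)]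
      by (rule continuous_on_closed_Un)
    show "K ` (S1 \<union> S2) \<subseteq> X" "F ` (S1 \<union> S2) \<subseteq> carrier H"
      using 1 2 by (auto simp: horizontal_def)
    fix s assume s: "s \<in> S1 \<union> S2"
    then have "K s \<in> X"
      using hor by (auto simp: horizontal_def)
    then obtain i where i: "i \<in> I" "K s \<in> domain i"
      using cover by blast
    have *: "\<forall>\<^sub>F t in nhds s. t \<in> S \<longrightarrow> F t \<otimes> inv chart i (K t) = F s \<otimes> inv chart i (K s)"
      if "closed S" "horizontal S K F" for S
    proof (cases "s \<in> S")
      case True
      then show ?thesis
        using horizontal_chart that i by blast
    next
      case False
      then have "\<forall>\<^sub>F t in nhds s. t \<in> - S"
        using that by (intro eventually_nhds_in_open) auto
      then show ?thesis
        by eventually_elim auto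
    qed
    show "\<exists>i\<in>I. K s \<in> domain i \<and> (\<forall>\<^sub>F t in nhds s. t \<in> S1 \<union> S2 \<longrightarrow>
        F t \<otimes> inv chart i (K t) = F s \<otimes> inv chart i (K s))"
      using i *[OF assms(1) 1] *[OF assms(2) 2]
      by (intro bexI[of _ i] conjI) (simp_all add: eventually_conj_iff imp_disjL)
  qed
  then show ?thesis
    by blast
qed

section \<open>Existence of horizontal sections over squares and paths\<close>

lemma horizontal_local:
  assumes "continuous_on S K" "K ` S \<subseteq> X" "s \<in> S"
  shows "\<exists>e>0. \<exists>F. horizontal (S \<inter> ball s e) K F"
proof -
  obtain i where i: "i \<in> I" "K s \<in> domain i"
    using assms cover by blast
  obtain U where U: "open U" "domain i = X \<inter> U"
    using open_domain[OF i(1)] by (auto simp: openin_open)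
  have "\<forall>\<^sub>F t in nhds s. t \<in> S \<longrightarrow> K t \<in> U"
    using assms(1,3) U i by (intro continuous_on_eventually_nhds eventually_nhds_in_open) auto
  then obtain e where e: "e > 0" "\<And>t. dist t s < e \<Longrightarrow> t \<in> S \<Longrightarrow> K t \<in> U"
    unfolding eventually_nhds_metric by blast
  have "horizontal (S \<inter> ball s e) K (\<lambda>t. chart i (K t))"
    unfolding horizontal_def
  proof (intro conjI ballI)
    show "continuous_on (S \<inter> ball s e) K"
      using assms(1) continuous_on_subset by blast
    show "K ` (S \<inter> ball s e) \<subseteq> X" "(\<lambda>t. chart i (K t)) ` (S \<inter> ball s e) \<subseteq> carrier H"
      using assms(2) i chart_closed by auto
    fix t assume t: "t \<in> S \<inter> ball s e"
    have "chart i (K r) \<otimes> inv chart i (K r) = \<one>" if "r \<in> S" for r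
      using that assms(2) i chart_closed by auto
    then show "\<exists>j\<in>I. K t \<in> domain j \<and> (\<forall>\<^sub>F r in nhds t. r \<in> S \<inter> ball s e \<longrightarrow>
        chart i (K r) \<otimes> inv chart j (K r) = chart i (K t) \<otimes> inv chart j (K t))"
      using t i U e assms(2) by (intro bexI[of _ i]) (auto simp: dist_commute)
  qed
  with e(1) show ?thesis
    by blast
qed

text \<open>Bolzano bisection is applied twice, each time gluing along a common edge: first
  vertically, to get a section over a thin strip around each s, then horizontally, to join the
  strips.\<close>

lemma horizontal_square_exists:
  fixes K :: "real \<times> real \<Rightarrow> 'x"
  assumes K: "continuous_on ({0..1} \<times> {0..1}) K" "K ` ({0..1} \<times> {0..1}) \<subseteq> X"
  shows "\<exists>F. horizontal ({0..1} \<times> {0..1}) K F"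
proof -
  define J where "J s d = {max 0 (s - d)..min 1 (s + d)}" for s d :: real
  have strip: "\<exists>d>0. \<exists>F. horizontal (J s d \<times> {0..1}) K F" if s: "s \<in> {0..1}" for s
  proof -
    define P where "P a b \<longleftrightarrow> (0 \<le> a \<and> b \<le> 1 \<longrightarrow> (\<exists>d>0. \<exists>F. horizontal (J s d \<times> {a..b}) K F))"
      for a b :: real
    have "(0::real) \<le> 1"
      by simp
    then have "P 0 1"
    proof (induction rule: Bolzano)
      case (trans a b c)
      show ?case
        unfolding P_def
      proof (intro impI)
        assume "0 \<le> a \<and> c \<le> 1"
        then obtain d1 d2 F1 F2 where d: "d1 > 0" "d2 > 0"
          and F: "horizontal (J s d1 \<times> {a..b}) K F1" "horizontal (J s d2 \<times> {b..c}) K F2"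
          using trans unfolding P_def by (meson order_trans)
        define d where "d = min d1 d2"
        have sub: "J s d \<subseteq> J s d1" "J s d \<subseteq> J s d2"
          by (auto simp: J_def d_def)
        have int: "(J s d \<times> {a..b}) \<inter> (J s d \<times> {b..c}) = J s d \<times> {b}"
          using trans by auto
        have un: "(J s d \<times> {a..b}) \<union> (J s d \<times> {b..c}) = J s d \<times> {a..c}"
          using trans by auto
        have "\<exists>F. horizontal ((J s d \<times> {a..b}) \<union> (J s d \<times> {b..c})) K F"
        proof (rule horizontal_glue)
          show "connected ((J s d \<times> {a..b}) \<inter> (J s d \<times> {b..c}))"
            unfolding int by (intro connected_Times) (auto simp: J_def)
          show "(J s d \<times> {a..b}) \<inter> (J s d \<times> {b..c}) \<noteq> {}"
            unfolding int using d s by (auto simp: J_def d_def)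
          show "horizontal (J s d \<times> {a..b}) K F1"
            by (rule horizontal_subset[OF F(1)]) (use sub in auto)
          show "horizontal (J s d \<times> {b..c}) K F2"
            by (rule horizontal_subset[OF F(2)]) (use sub in auto)
        qed (auto simp: J_def intro!: closed_Times)
        then show "\<exists>d>0. \<exists>F. horizontal (J s d \<times> {a..c}) K F"
          unfolding un using d by (intro exI[of _ d]) (auto simp: d_def)
      qed
    next
      case (local t)
      then have st: "(s, t) \<in> {0..1} \<times> {0..1}"
        using s by auto
      obtain e F where e: "e > 0" "horizontal (({0..1} \<times> {0..1}) \<inter> ball (s, t) e) K F"
        using horizontal_local[OF K st] by blast
      have "P a b" if "a \<le> t" "t \<le> b" "b - a < e / 2" for a b
        unfolding P_def
      proof (intro impI exI conjI)
        assume ab: "0 \<le> a \<and> b \<le> 1"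
        \<comment> \<open>Half-width e/3 and height below e/2 keep the rectangle inside the ball, as
          the two distances add up to less than e.\<close>
        show "e / 3 > 0"
          using e by simp
        have "J s (e / 3) \<times> {a..b} \<subseteq> ({0..1} \<times> {0..1}) \<inter> ball (s, t) e"
        proof safe
          fix x y assume x: "x \<in> J s (e / 3)" and y: "y \<in> {a..b}"
          show "x \<in> {0..1}" "y \<in> {0..1}"
            using x y ab by (auto simp: J_def)
          have "dist (s, t) (x, y) \<le> \<bar>s - x\<bar> + \<bar>t - y\<bar>"
            using dist_Pair_Pair[of s t x y] sqrt_sum_squares_le_sum_abs[of "dist s x" "dist t y"]
            by (simp add: dist_real_def)
          also have "\<dots> < e"
            using x y that by (auto simp: J_def)
          finally show "(x, y) \<in> ball (s, t) e"
            by simp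
        qed
        then show "horizontal (J s (e / 3) \<times> {a..b}) K F"
          using e(2) horizontal_subset by blast
      qed
      then show ?case
        using e(1) by (intro exI[of _ "e / 2"]) auto
    qed
    then show ?thesis
      by (simp add: P_def)
  qed
  define P where "P a b \<longleftrightarrow> (0 \<le> a \<and> b \<le> 1 \<longrightarrow> (\<exists>F. horizontal ({a..b} \<times> {0..1}) K F))"
    for a b :: real
  have "(0::real) \<le> 1"
    by simp
  then have "P 0 1"
  proof (induction rule: Bolzano)
    case (trans a b c)
    show ?case
      unfolding P_def
    proof (intro impI)
      assume "0 \<le> a \<and> c \<le> 1"
      then obtain F1 F2
        where F: "horizontal ({a..b} \<times> {0..1}) K F1" "horizontal ({b..c} \<times> {0..1}) K F2"
        using trans unfolding P_def by (meson order_trans)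
      have int: "({a..b} \<times> {0..1::real}) \<inter> ({b..c} \<times> {0..1}) = {b} \<times> {0..1}"
        using trans by auto
      have un: "({a..b} \<times> {0..1::real}) \<union> ({b..c} \<times> {0..1}) = {a..c} \<times> {0..1}"
        using trans by auto
      have "\<exists>F. horizontal (({a..b} \<times> {0..1}) \<union> ({b..c} \<times> {0..1})) K F"
        by (rule horizontal_glue[OF _ _ _ _ F])
          (auto simp: int intro!: closed_Times connected_Times)
      then show "\<exists>F. horizontal ({a..c} \<times> {0..1}) K F"
        unfolding un .
    qed
  next
    case (local s)
    then obtain d F where d: "d > 0" "horizontal (J s d \<times> {0..1}) K F"
      using strip[of s] by auto
    have "P a b" if "a \<le> s" "s \<le> b" "b - a < d" for a b
      unfolding P_def
    proof (intro impI exI)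
      assume "0 \<le> a \<and> b \<le> 1"
      then have "{a..b} \<times> {0..1} \<subseteq> J s d \<times> {0..1::real}"
        using that by (auto simp: J_def)
      then show "horizontal ({a..b} \<times> {0..1}) K F"
        using d(2) horizontal_subset by blast
    qed
    then show ?case
      using d(1) by blast
  qed
  then show ?thesis
    by (simp add: P_def)
qed

lemma horizontal_path_exists:
  assumes "path g" "path_image g \<subseteq> X"
  shows "\<exists>F. horizontal {0..1} g F \<and> F 0 = \<one>"
proof -
  \<comment> \<open>The path is regarded as a square that ignores its first coordinate, so that no
    separate bisection is needed.\<close>
  have "continuous_on ({0..1} \<times> {0..1}) (\<lambda>z::real \<times> real. g (snd z))"
    using assms(1) unfolding path_def
    by (rule continuous_on_compose2) (auto intro!: continuous_intros)
  moreover have "(\<lambda>z::real \<times> real. g (snd z)) ` ({0..1} \<times> {0..1}) \<subseteq> X"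
    using assms(2) by (auto simp: path_image_def)
  ultimately obtain F where "horizontal ({0..1} \<times> {0..1}) (\<lambda>z::real \<times> real. g (snd z)) F"
    using horizontal_square_exists[of "\<lambda>z. g (snd z)"] by blast
  then have "horizontal {0..1} (\<lambda>t. g (snd (0::real, t))) (\<lambda>t. F (0, t))"
    by (rule horizontal_compose) (auto intro!: continuous_intros)
  then have F: "horizontal {0..1} g (\<lambda>t. F (0, t))"
    by simp
  then have "F (0, 0) \<in> carrier H"
    by (auto simp: horizontal_def)
  then show ?thesis
    using horizontal_mult_left[OF F, of "inv F (0, 0)"]
    by (intro exI[of _ "\<lambda>t. inv F (0, 0) \<otimes> F (0, t)"]) auto
qed

section \<open>Holonomy and its homotopy invariance\<close>

definition holonomy :: "(real \<Rightarrow> 'x) \<Rightarrow> 'a" where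
  "holonomy g = (SOME F. horizontal {0..1} g F \<and> F 0 = \<one>) 1"

lemma holonomy_eq:
  assumes F: "horizontal {0..1} g F"
  shows "F 1 = F 0 \<otimes> holonomy g" "holonomy g \<in> carrier H"
proof -
  have "\<exists>F. horizontal {0..1} g F \<and> F 0 = \<one>"
    by (rule horizontal_path_exists) (use F in \<open>auto simp: horizontal_def path_def path_image_def\<close>)
  then obtain E where E: "horizontal {0..1} g E" "E 0 = \<one>" "holonomy g = E 1"
    unfolding holonomy_def by (metis (mono_tags, lifting) someI_ex)
  have c: "F 0 \<in> carrier H" "F 1 \<in> carrier H" "E 1 \<in> carrier H"
    using E F by (auto simp: horizontal_def)
  then show "holonomy g \<in> carrier H"
    by (simp add: E(3))
  have "F 1 \<otimes> inv E 1 = F 0 \<otimes> inv E 0"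
    by (rule horizontal_unique[OF F E(1)]) auto
  then show "F 1 = F 0 \<otimes> holonomy g"
    using c E by (simp add: inv_solve_right')
qed

lemma holonomy_closed: "path g \<Longrightarrow> path_image g \<subseteq> X \<Longrightarrow> holonomy g \<in> carrier H"
  using horizontal_path_exists holonomy_eq(2) by blast

lemma holonomy_join:
  assumes "path g" "path_image g \<subseteq> X" "path h" "path_image h \<subseteq> X" "pathfinish g = pathstart h"
  shows "holonomy (g +++ h) = holonomy g \<otimes> holonomy h"
proof -
  obtain F where F: "horizontal {0..1} (g +++ h) F" "F 0 = \<one>"
    using horizontal_path_exists[of "g +++ h"] assms by (auto simp: path_image_join)
  have "horizontal {0..1} (\<lambda>t. (g +++ h) (t / 2)) (\<lambda>t. F (t / 2))"
    by (rule horizontal_compose[OF F(1)]) (auto intro!: continuous_intros)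
  then have 1: "horizontal {0..1} g (\<lambda>t. F (t / 2))"
    by (rule horizontal_cong) (auto simp: joinpaths_def)
  have "horizontal {0..1} (\<lambda>t. (g +++ h) ((1 + t) / 2)) (\<lambda>t. F ((1 + t) / 2))"
    by (rule horizontal_compose[OF F(1)]) (auto intro!: continuous_intros)
  then have 2: "horizontal {0..1} h (\<lambda>t. F ((1 + t) / 2))"
    by (rule horizontal_cong)
      (use assms(5) in \<open>auto simp: joinpaths_def pathfinish_def pathstart_def field_simps\<close>)
  show ?thesis
    using holonomy_eq[OF F(1)] holonomy_eq[OF 1] holonomy_eq[OF 2] F(2) by simp
qed

text \<open>A section over the whole homotopy restricts to sections over both paths. On the two
  edges where the end points stay fixed it is constant, by comparison with the constant section
  \<one> along a constant path.\<close>

lemma holonomy_homotopic: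
  assumes "homotopic_paths X g h"
  shows "holonomy g = holonomy h"
proof -
  obtain K :: "real \<times> real \<Rightarrow> 'x"
    where K: "continuous_on ({0..1} \<times> {0..1}) K" "K ` ({0..1} \<times> {0..1}) \<subseteq> X"
    and K0: "\<And>t. t \<in> {0..1} \<Longrightarrow> K (0, t) = g t" and K1: "\<And>t. t \<in> {0..1} \<Longrightarrow> K (1, t) = h t"
    and ends: "\<And>s. s \<in> {0..1} \<Longrightarrow> K (s, 0) = K (0, 0)" "\<And>s. s \<in> {0..1} \<Longrightarrow> K (s, 1) = K (0, 1)"
  proof -
    obtain K :: "real \<times> real \<Rightarrow> 'x" where "continuous_on ({0..1} \<times> {0..1}) K" "K \<in> ({0..1} \<times> {0..1}) \<rightarrow> X"
      "\<forall>t\<in>{0..1}. K (0, t) = g t" "\<forall>t\<in>{0..1}. K (1, t) = h t"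
      "\<forall>s\<in>{0..1::real}. K (s, 0) = g 0 \<and> K (s, 1) = g 1"
      using assms unfolding homotopic_paths by (auto simp: pathstart_def pathfinish_def)
    then show thesis
      by (intro that[of K]) (simp_all add: image_subset_iff_funcset)
  qed
  obtain F where F: "horizontal ({0..1} \<times> {0..1}) K F"
    using horizontal_square_exists[OF K] by blast
  have c: "F (s, t) \<in> carrier H" if "s \<in> {0..1}" "t \<in> {0..1}" for s t
    using F that by (auto simp: horizontal_def)
  have "horizontal {0..1} (\<lambda>t. K (0, t)) (\<lambda>t. F (0, t))"
    by (rule horizontal_compose[OF F]) (auto intro!: continuous_intros)
  then have g: "horizontal {0..1} g (\<lambda>t. F (0, t))"
    by (rule horizontal_cong) (simp_all add: K0)
  have "horizontal {0..1} (\<lambda>t. K (1, t)) (\<lambda>t. F (1, t))"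
    by (rule horizontal_compose[OF F]) (auto intro!: continuous_intros)
  then have h: "horizontal {0..1} h (\<lambda>t. F (1, t))"
    by (rule horizontal_cong) (simp_all add: K1)
  have edge: "F (0, t) = F (1, t)" if t: "t \<in> {0, 1}" for t
  proof -
    have "horizontal {0..1} (\<lambda>s. K (s, t)) (\<lambda>s. F (s, t))"
      by (rule horizontal_compose[OF F]) (use t in \<open>auto intro!: continuous_intros\<close>)
    then have E: "horizontal {0..1} (\<lambda>s. K (0, t)) (\<lambda>s. F (s, t))"
      by (rule horizontal_cong) (use t ends in auto)
    have "(0::real, t) \<in> {0..1} \<times> {0..1::real}"
      using t by auto
    then have X: "K (0, t) \<in> X"
      using K(2) by blast
    then obtain i where i: "i \<in> I" "K (0, t) \<in> domain i"
      using cover by blast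
    have C: "horizontal {0..1} (\<lambda>s. K (0, t)) (\<lambda>s::real. \<one>)"
      unfolding horizontal_def using i X by auto
    show ?thesis
      using horizontal_unique[OF E C, of 0 1] c t by auto
  qed
  have "F (0, 0) \<otimes> holonomy g = F (0, 0) \<otimes> holonomy h"
    using holonomy_eq(1)[OF g] holonomy_eq(1)[OF h] edge by simp
  then show ?thesis
    using c holonomy_eq(2)[OF g] holonomy_eq(2)[OF h] by simp
qed

lemma holonomy_hom:
  obtains \<rho> where "\<rho> \<in> hom (fundamental_group X a) H"
    "\<And>g. g \<in> loops_at X a \<Longrightarrow> \<rho> (path_class X g) = holonomy g"
proof -
  define \<rho> where "\<rho> = (\<lambda>C. holonomy (SOME g. g \<in> C))"
  have eq: "\<rho> (path_class X g) = holonomy g" if "g \<in> loops_at X a" for g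
  proof -
    have "g \<in> path_class X g"
      using that by (auto simp: path_class_def loops_at_def)
    then have "(SOME g'. g' \<in> path_class X g) \<in> path_class X g"
      by (rule someI[of "\<lambda>g'. g' \<in> path_class X g"])
    then show ?thesis
      unfolding \<rho>_def using holonomy_homotopic by (auto simp: path_class_def)
  qed
  have "\<rho> \<in> hom (fundamental_group X a) H"
  proof (rule homI)
    fix x y assume "x \<in> carrier (fundamental_group X a)" "y \<in> carrier (fundamental_group X a)"
    then obtain g h where "g \<in> loops_at X a" "h \<in> loops_at X a"
      "x = path_class X g" "y = path_class X h"
      by (auto simp: fundamental_group_def)
    then show "\<rho> (x \<otimes>\<^bsub>fundamental_group X a\<^esub> y) = \<rho> x \<otimes> \<rho> y"
      by (simp add: mult_fundamental_group eq loops_at_join)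
        (auto simp: loops_at_def intro!: holonomy_join)
  qed (auto simp: fundamental_group_def eq intro!: holonomy_closed, auto simp: loops_at_def)
  with eq that show thesis
    by blast
qed

end


section \<open>Representations of triangle groups\<close>

definition GL2 :: "(complex \<times> complex \<times> complex \<times> complex) monoid" where
  "GL2 = \<lparr>carrier = {(a, b, c, d). a * d - b * c \<noteq> 0},
     mult = (\<lambda>(a, b, c, d) (a', b', c', d').
       (a * a' + b * c', a * b' + b * d', c * a' + d * c', c * b' + d * d')),
     one = (1, 0, 0, 1)\<rparr>"

text \<open>Orders are taken modulo these, that is in PGL2: the determinant of a product is forced
  by its factors, so only the ratio of its eigenvalues can be prescribed.\<close>

definition scalar_mats :: "(complex \<times> complex \<times> complex \<times> complex) set" where
  "scalar_mats = {(a, b, c, d). a = d \<and> b = 0 \<and> c = 0 \<and> a \<noteq> 0}"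

lemma group_GL2: "group GL2"
proof (rule groupI)
  show "x \<otimes>\<^bsub>GL2\<^esub> y \<in> carrier GL2" if "x \<in> carrier GL2" "y \<in> carrier GL2" for x y
  proof -
    obtain a b c d a' b' c' d' where xy: "x = (a, b, c, d)" "y = (a', b', c', d')"
      by (metis surj_pair)
    have "(a * a' + b * c') * (c * b' + d * d') - (a * b' + b * d') * (c * a' + d * c')
        = (a * d - b * c) * (a' * d' - b' * c')"
      by (simp add: algebra_simps)
    also have "\<dots> \<noteq> 0"
      using that by (simp add: GL2_def xy)
    finally show ?thesis
      by (simp add: GL2_def xy)
  qed
  show "\<exists>y\<in>carrier GL2. y \<otimes>\<^bsub>GL2\<^esub> x = \<one>\<^bsub>GL2\<^esub>" if "x \<in> carrier GL2" for x
  proof -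
    obtain a b c d where x: "x = (a, b, c, d)"
      by (metis surj_pair)
    define D where "D = a * d - b * c"
    have D: "D \<noteq> 0"
      using that by (simp add: GL2_def x D_def)
    have "d * a \<noteq> b * c"
      using D by (auto simp: D_def mult.commute)
    then have "(d / D, - b / D, - c / D, a / D) \<in> carrier GL2"
      using D by (simp add: GL2_def)
    moreover have "(d / D, - b / D, - c / D, a / D) \<otimes>\<^bsub>GL2\<^esub> x = \<one>\<^bsub>GL2\<^esub>"
      using D by (auto simp: GL2_def x field_simps) (auto simp: D_def algebra_simps)
    ultimately show ?thesis
      by blast
  qed
qed (auto simp: GL2_def algebra_simps)

lemma scalar_mats_normal: "scalar_mats \<lhd> GL2"
proof -
  interpret group GL2
    by (rule group_GL2)
  have central: "x \<otimes>\<^bsub>GL2\<^esub> s = s \<otimes>\<^bsub>GL2\<^esub> x" if "s \<in> scalar_mats" for x s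
    using that by (cases x) (auto simp: scalar_mats_def GL2_def)
  have sub: "s \<in> carrier GL2" if "s \<in> scalar_mats" for s
    using that by (auto simp: scalar_mats_def GL2_def)
  have "subgroup scalar_mats GL2"
  proof (rule subgroupI)
    show "scalar_mats \<noteq> {}"
      by (auto simp: scalar_mats_def)
    fix s assume s: "s \<in> scalar_mats"
    then obtain a where a: "s = (a, 0, 0, a)" "a \<noteq> 0"
      by (auto simp: scalar_mats_def)
    then have "(inverse a, 0, 0, inverse a) \<otimes>\<^bsub>GL2\<^esub> s = \<one>\<^bsub>GL2\<^esub>"
      by (simp add: GL2_def)
    moreover have inv: "(inverse a, 0, 0, inverse a) \<in> scalar_mats"
      using a by (simp add: scalar_mats_def)
    ultimately show "inv\<^bsub>GL2\<^esub> s \<in> scalar_mats"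
      using inv_equality sub s by metis
    show "s \<otimes>\<^bsub>GL2\<^esub> t \<in> scalar_mats" if "t \<in> scalar_mats" for t
      using s that by (auto simp: scalar_mats_def GL2_def)
  qed (use sub in auto)
  then show ?thesis
  proof (rule normal_invI)
    fix x s assume "x \<in> carrier GL2" "s \<in> scalar_mats"
    then show "x \<otimes>\<^bsub>GL2\<^esub> s \<otimes>\<^bsub>GL2\<^esub> inv\<^bsub>GL2\<^esub> x \<in> scalar_mats"
      by (simp add: central sub m_assoc)
  qed
qed

lemma cis_root_of_unity_power:
  fixes d k :: nat
  assumes "d > 0"
  shows "cis (2 * pi / d) ^ k = 1 \<longleftrightarrow> d dvd k"
proof -
  have "cis (2 * pi / d) ^ k = exp (2 * of_real pi * \<i> * of_nat k / of_nat d)"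
    unfolding Complex.DeMoivre by (simp add: cis_conv_exp mult_ac)
  then show ?thesis
    using complex_root_unity_eq_1[of d k] assms by simp
qed

text \<open>A product of an upper and a lower triangular matrix with prescribed diagonals can be given any
  trace, hence any pair of eigenvalues with the right product.\<close>

lemma triangle_group_representation:
  fixes p q d :: nat
  assumes "p \<ge> 2" "q \<ge> 2" "d \<ge> 2"
  obtains x y where "x \<in> carrier GL2" "y \<in> carrier GL2"
    "x [^]\<^bsub>GL2\<^esub> p = \<one>\<^bsub>GL2\<^esub>" "y [^]\<^bsub>GL2\<^esub> q = \<one>\<^bsub>GL2\<^esub>"
    "\<And>k::nat. (x \<otimes>\<^bsub>GL2\<^esub> y) [^]\<^bsub>GL2\<^esub> k \<in> scalar_mats \<longleftrightarrow> d dvd k"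
proof -
  interpret group GL2
    by (rule group_GL2)
  define \<xi> \<eta> \<zeta> where "\<xi> = cis (2 * pi / p)" and "\<eta> = cis (2 * pi / q)" and "\<zeta> = cis (2 * pi / d)"
  have unit: "\<xi> ^ p = 1" "\<xi> \<noteq> 1" "\<eta> ^ q = 1" "\<eta> \<noteq> 1" "\<zeta> \<noteq> 1" "\<xi> \<noteq> 0" "\<eta> \<noteq> 0" "\<zeta> \<noteq> 0"
    using assms cis_root_of_unity_power[of p p] cis_root_of_unity_power[of p 1]
      cis_root_of_unity_power[of q q] cis_root_of_unity_power[of q 1]
      cis_root_of_unity_power[of d 1]
    by (auto simp: \<xi>_def \<eta>_def \<zeta>_def)
  \<comment> \<open>\<kappa>1 and \<kappa>2 are the intended eigenvalues of the product: their ratio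
    is \<zeta>, a primitive d-th root of unity, and their product is the determinant \<xi>
    \<eta>.\<close>
  define \<kappa>2 where "\<kappa>2 = csqrt (\<xi> * \<eta> / \<zeta>)"
  define \<kappa>1 where "\<kappa>1 = \<zeta> * \<kappa>2"
  have prod: "\<kappa>1 * \<kappa>2 = \<xi> * \<eta>"
    using power2_csqrt[of "\<xi> * \<eta> / \<zeta>"] unit
    by (simp add: \<kappa>1_def \<kappa>2_def power2_eq_square mult.assoc)
  have "\<kappa>2 \<noteq> 0" "\<kappa>1 \<noteq> \<kappa>2"
    using prod unit by (auto simp: \<kappa>1_def)
  \<comment> \<open>Chosen so that the trace of the product of \<open>x\<close> and
    \<open>y\<close>, which is 1 + c + \<xi> \<eta>, equals \<kappa>1 + \<kappa>2.\<close>
  define c where "c = \<kappa>1 + \<kappa>2 - 1 - \<xi> * \<eta>"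
  define x y :: "complex \<times> complex \<times> complex \<times> complex"
    where "x = (1, 1, 0, \<xi>)" and "y = (1, 0, c, \<eta>)"
  have xy: "x \<in> carrier GL2" "y \<in> carrier GL2"
    using unit by (auto simp: GL2_def x_def y_def)
  have "x [^]\<^bsub>GL2\<^esub> n = (1, \<Sum>i<n. \<xi> ^ i, 0, \<xi> ^ n)" for n :: nat
  proof (induction n)
    case (Suc n)
    have "(\<Sum>i<Suc n. \<xi> ^ i) = 1 + (\<Sum>i<n. \<xi> ^ i) * \<xi>"
      by (subst sum.lessThan_Suc_shift) (simp add: sum_distrib_left mult.commute)
    with Suc show ?case
      by (simp add: GL2_def x_def mult.commute)
  qed (simp add: GL2_def)
  then have "x [^]\<^bsub>GL2\<^esub> p = \<one>\<^bsub>GL2\<^esub>"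
    using unit by (simp add: geometric_sum GL2_def)
  moreover have "y [^]\<^bsub>GL2\<^esub> n = (1, 0, c * (\<Sum>i<n. \<eta> ^ i), \<eta> ^ n)" for n :: nat
    by (induction n) (simp_all add: GL2_def y_def algebra_simps)
  then have "y [^]\<^bsub>GL2\<^esub> q = \<one>\<^bsub>GL2\<^esub>"
    using unit by (simp add: geometric_sum GL2_def)
  moreover have "(x \<otimes>\<^bsub>GL2\<^esub> y) [^]\<^bsub>GL2\<^esub> k \<in> scalar_mats \<longleftrightarrow> d dvd k" for k :: nat
  proof -
    have M: "x \<otimes>\<^bsub>GL2\<^esub> y = (1 + c, \<eta>, \<xi> * c, \<xi> * \<eta>)"
      by (simp add: GL2_def x_def y_def)
    \<comment> \<open>Cayley-Hamilton: the k-th power is u M - v I for the product matrix M, and the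
      eigenvalues obey the same relation. As M has the nonzero off-diagonal entry \<eta>, the power
      is scalar exactly when u = 0, that is when the eigenvalue powers agree.\<close>
    have "\<exists>u v. \<kappa>1 ^ k = u * \<kappa>1 - v \<and> \<kappa>2 ^ k = u * \<kappa>2 - v \<and>
        (x \<otimes>\<^bsub>GL2\<^esub> y) [^]\<^bsub>GL2\<^esub> k = (u * (1 + c) - v, u * \<eta>, u * (\<xi> * c), u * (\<xi> * \<eta>) - v)"
    proof (induction k)
      case 0
      show ?case
        by (intro exI[of _ 0] exI[of _ "-1"]) (simp add: GL2_def)
    next
      case (Suc k)
      then obtain u v where uv: "\<kappa>1 ^ k = u * \<kappa>1 - v" "\<kappa>2 ^ k = u * \<kappa>2 - v"
        "(x \<otimes>\<^bsub>GL2\<^esub> y) [^]\<^bsub>GL2\<^esub> k = (u * (1 + c) - v, u * \<eta>, u * (\<xi> * c), u * (\<xi> * \<eta>) - v)"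
        by blast
      have "(x \<otimes>\<^bsub>GL2\<^esub> y) [^]\<^bsub>GL2\<^esub> Suc k =
         ((u * (1 + c) - v) * (1 + c) + u * \<eta> * (\<xi> * c),
          (u * (1 + c) - v) * \<eta> + u * \<eta> * (\<xi> * \<eta>),
          u * (\<xi> * c) * (1 + c) + (u * (\<xi> * \<eta>) - v) * (\<xi> * c),
          u * (\<xi> * c) * \<eta> + (u * (\<xi> * \<eta>) - v) * (\<xi> * \<eta>))"
        unfolding nat_pow_Suc uv(3) unfolding M by (simp add: GL2_def)
      moreover have "(u * (1 + c) - v) * (1 + c) + u * \<eta> * (\<xi> * c)
          = (u * (\<kappa>1 + \<kappa>2) - v) * (1 + c) - u * (\<kappa>1 * \<kappa>2)"
        unfolding prod by (simp add: c_def algebra_simps)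
      moreover have "(u * (1 + c) - v) * \<eta> + u * \<eta> * (\<xi> * \<eta>) = (u * (\<kappa>1 + \<kappa>2) - v) * \<eta>"
        by (simp add: c_def algebra_simps)
      moreover have "u * (\<xi> * c) * (1 + c) + (u * (\<xi> * \<eta>) - v) * (\<xi> * c)
          = (u * (\<kappa>1 + \<kappa>2) - v) * (\<xi> * c)"
        by (simp add: c_def algebra_simps)
      moreover have "u * (\<xi> * c) * \<eta> + (u * (\<xi> * \<eta>) - v) * (\<xi> * \<eta>)
          = (u * (\<kappa>1 + \<kappa>2) - v) * (\<xi> * \<eta>) - u * (\<kappa>1 * \<kappa>2)"
        unfolding prod by (simp add: c_def algebra_simps)
      moreover have "\<kappa>1 ^ Suc k = (u * (\<kappa>1 + \<kappa>2) - v) * \<kappa>1 - u * (\<kappa>1 * \<kappa>2)"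
        "\<kappa>2 ^ Suc k = (u * (\<kappa>1 + \<kappa>2) - v) * \<kappa>2 - u * (\<kappa>1 * \<kappa>2)"
        by (simp_all add: uv algebra_simps)
      ultimately show ?case
        by (intro exI[of _ "u * (\<kappa>1 + \<kappa>2) - v"] exI[of _ "u * (\<kappa>1 * \<kappa>2)"]) simp
    qed
    then obtain u v where uv: "\<kappa>1 ^ k = u * \<kappa>1 - v" "\<kappa>2 ^ k = u * \<kappa>2 - v"
      "(x \<otimes>\<^bsub>GL2\<^esub> y) [^]\<^bsub>GL2\<^esub> k = (u * (1 + c) - v, u * \<eta>, u * (\<xi> * c), u * (\<xi> * \<eta>) - v)"
      by blast
    have "(x \<otimes>\<^bsub>GL2\<^esub> y) [^]\<^bsub>GL2\<^esub> k \<in> scalar_mats \<longleftrightarrow> u = 0"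
    proof
      assume "(x \<otimes>\<^bsub>GL2\<^esub> y) [^]\<^bsub>GL2\<^esub> k \<in> scalar_mats"
      then show "u = 0"
        using unit by (simp add: uv(3) scalar_mats_def)
    next
      assume "u = 0"
      moreover from this have "v \<noteq> 0"
        using uv(2) \<open>\<kappa>2 \<noteq> 0\<close> by auto
      ultimately show "(x \<otimes>\<^bsub>GL2\<^esub> y) [^]\<^bsub>GL2\<^esub> k \<in> scalar_mats"
        by (simp add: uv(3) scalar_mats_def)
    qed
    also have "\<dots> \<longleftrightarrow> \<kappa>1 ^ k = \<kappa>2 ^ k"
      using \<open>\<kappa>1 \<noteq> \<kappa>2\<close> by (simp add: uv)
    also have "\<dots> \<longleftrightarrow> \<zeta> ^ k = 1"
      using \<open>\<kappa>2 \<noteq> 0\<close> by (simp add: \<kappa>1_def power_mult_distrib)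
    also have "\<dots> \<longleftrightarrow> d dvd k"
      unfolding \<zeta>_def using assms by (intro cis_root_of_unity_power) simp
    finally show ?thesis .
  qed
  ultimately show thesis
    using xy that by blast
qed


section \<open>The exterior of a torus knot\<close>

locale torus_knot_exterior =
  fixes p q :: nat
  assumes p: "p \<ge> 2" and q: "q \<ge> 2" and coprime: "coprime p q"
begin

abbreviation \<phi> :: tube where "\<phi> \<equiv> torus_knot_tube p q"

abbreviation E :: "(complex \<times> complex) set" where "E \<equiv> knot_exterior \<phi>"

abbreviation G :: "(real \<Rightarrow> complex \<times> complex) set monoid" where "G \<equiv> knot_group \<phi>"

lemma boundary_in_exterior:
  assumes "norm u = 1" "norm v = 1"
  shows "\<phi> (u, v) \<in> E"
proof -
  have "\<phi> (u, v) \<notin> \<phi> ` (sphere 0 1 \<times> ball 0 1)"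
  proof
    assume "\<phi> (u, v) \<in> \<phi> ` (sphere 0 1 \<times> ball 0 1)"
    then obtain u' v' where *: "u' \<in> sphere 0 1" "v' \<in> ball 0 1" "\<phi> (u, v) = \<phi> (u', v')"
      by auto
    have "(u, v) = (u', v')"
      by (rule inj_onD[OF inj_on_torus_knot_tube[of p q] *(3)])
        (use p q coprime assms * in auto)
    then show False
      using assms * by auto
  qed
  then show ?thesis
    using torus_knot_tube_in_sphere[of u p q v] assms by (auto simp: knot_exterior_def)
qed

sublocale group G
  unfolding knot_group_def by (rule group_fundamental_group) (simp add: boundary_in_exterior)

section \<open>The peripheral torus and its universal covering by the plane\<close>

definition torus_map :: "real \<times> real \<Rightarrow> complex \<times> complex" where
  "torus_map = (\<lambda>(x, y). \<phi> (cis (2 * pi * x), cis (2 * pi * y)))"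

lemma torus_map_add_int: "torus_map (x + of_int m, y + of_int n) = torus_map (x, y)"
  by (simp add: torus_map_def distrib_left flip: cis_mult)

lemma continuous_on_torus_map: "continuous_on S torus_map"
proof -
  have "continuous_on S (\<lambda>z. (cis (2 * pi * fst z), cis (2 * pi * snd z)))"
    by (intro continuous_intros)
  then show ?thesis
    unfolding torus_map_def case_prod_unfold
    using continuous_on_compose2[OF continuous_on_torus_knot_tube[of UNIV]] by blast
qed

lemma torus_map_in_exterior: "torus_map z \<in> E"
  by (auto simp: torus_map_def boundary_in_exterior split: prod.split)

definition torus_class :: "int \<Rightarrow> int \<Rightarrow> (real \<Rightarrow> complex \<times> complex) set" where
  "torus_class m n = path_class E (torus_map \<circ> linepath (0, 0) (of_int m, of_int n))"

lemma torus_loop: "torus_map \<circ> linepath (0, 0) (of_int m, of_int n) \<in> loops_at E (\<phi> (1, 1))"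
proof -
  have "path (torus_map \<circ> linepath (0, 0) (of_int m, of_int n))"
    by (intro path_continuous_image continuous_on_torus_map) simp
  moreover have "torus_map (0, 0) = \<phi> (1, 1)" "torus_map (of_int m, of_int n) = \<phi> (1, 1)"
    using torus_map_add_int[of 0 m 0 n] by (simp_all add: torus_map_def)
  ultimately show ?thesis
    using torus_map_in_exterior
    by (auto simp: loops_at_def path_image_compose pathstart_compose pathfinish_compose)
qed

lemma torus_class_closed: "torus_class m n \<in> carrier G"
  unfolding torus_class_def knot_group_def fundamental_group_def using torus_loop by simp

text \<open>The second loop lifts to the plane starting at any lattice point, so the product lifts
  to a broken line, which is homotopic in the plane to the straight segment with the same
  ends.\<close>

lemma torus_class_mult: "torus_class m n \<otimes>\<^bsub>G\<^esub> torus_class m' n' = torus_class (m + m') (n + n')"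
proof -
  define a b where "a = (real_of_int m, real_of_int n)"
    and "b = (real_of_int (m + m'), real_of_int (n + n'))"
  have eq: "torus_map \<circ> linepath (0, 0) (of_int m', of_int n') = torus_map \<circ> linepath a b"
  proof
    fix t
    have "linepath a b t = (t * of_int m' + of_int m, t * of_int n' + of_int n)"
      by (simp add: linepath_def a_def b_def algebra_simps)
    then show "(torus_map \<circ> linepath (0, 0) (of_int m', of_int n')) t
        = (torus_map \<circ> linepath a b) t"
      by (simp only: o_apply torus_map_add_int) (simp add: linepath_def)
  qed
  have "homotopic_paths UNIV (linepath (0, 0) a +++ linepath a b) (linepath (0, 0) b)"
    by (rule homotopic_paths_linear) auto
  then have "homotopic_paths E (torus_map \<circ> (linepath (0, 0) a +++ linepath a b))
      (torus_map \<circ> linepath (0, 0) b)"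
    by (rule homotopic_paths_continuous_image)
      (auto simp: continuous_on_torus_map torus_map_in_exterior)
  then have "path_class E ((torus_map \<circ> linepath (0, 0) a) +++ (torus_map \<circ> linepath a b))
      = path_class E (torus_map \<circ> linepath (0, 0) b)"
    by (simp add: path_class_eqI path_compose_join)
  then show ?thesis
    using torus_loop[of m n] torus_loop[of m' n']
    by (simp add: torus_class_def knot_group_def mult_fundamental_group eq)
      (simp add: a_def b_def)
qed

lemma torus_class_zero: "torus_class 0 0 = \<one>\<^bsub>G\<^esub>"
  using torus_class_mult[of 0 0 0 0] torus_class_closed[of 0 0] by simp

lemma meridian_eq: "meridian \<phi> = torus_class 0 1"
  by (simp add: meridian_def torus_class_def torus_map_def linepath_def comp_def cis_zero)

lemma longitude_eq: "longitude \<phi> k = torus_class 1 k"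
  by (simp add: longitude_def torus_class_def torus_map_def linepath_def comp_def mult_ac)

lemma torus_class_meridian_power: "torus_class 0 k = torus_class 0 1 [^]\<^bsub>G\<^esub> k"
proof -
  have nat: "torus_class 0 (int n) = torus_class 0 1 [^]\<^bsub>G\<^esub> n" for n
  proof (induction n)
    case (Suc n)
    then show ?case
      using torus_class_mult[of 0 "int n" 0 1] by (simp add: add.commute)
  qed (simp add: torus_class_zero)
  have "torus_class 0 (- int n) = inv\<^bsub>G\<^esub> torus_class 0 (int n)" for n
    using torus_class_mult[of 0 "- int n" 0 "int n"]
    by (intro inv_equality[symmetric]) (simp_all add: torus_class_zero torus_class_closed)
  then show ?thesis
    using nat
    by (cases k rule: int_cases3) (simp_all add: int_pow_neg int_pow_int torus_class_closed torus_class_zero)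
qed

text \<open>The circle action whose orbits are the Seifert fibres. The tube is equivariant, so
  \<open>torus_class 1 0\<close> is the orbit of the base point.\<close>

definition rotate :: "complex \<Rightarrow> complex \<times> complex \<Rightarrow> complex \<times> complex" where
  "rotate u z = (u ^ p * fst z, u ^ q * snd z)"

lemma rotate_tube: "rotate u (\<phi> (u', v)) = \<phi> (u * u', v)"
  by (simp add: rotate_def torus_knot_tube_def power_mult_distrib)

lemma rotate_rotate: "rotate u (rotate u' z) = rotate (u * u') z"
  by (simp add: rotate_def power_mult_distrib)

lemma rotate_one [simp]: "rotate 1 z = z"
  by (simp add: rotate_def)

lemma rotate_exterior:
  assumes "norm u = 1" "z \<in> E"
  shows "rotate u z \<in> E"
proof -
  have sphere: "rotate u z \<in> sphere 0 1"
    using assms by (cases z)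
      (simp add: rotate_def knot_exterior_def norm_Pair norm_mult norm_power)
  have "rotate u z \<notin> \<phi> ` (sphere 0 1 \<times> ball 0 1)"
  proof
    assume "rotate u z \<in> \<phi> ` (sphere 0 1 \<times> ball 0 1)"
    then obtain u' v where *: "u' \<in> sphere 0 1" "v \<in> ball 0 1" "rotate u z = \<phi> (u', v)"
      by auto
    have "u \<noteq> 0"
      using assms(1) by auto
    then have "z = rotate (inverse u) (rotate u z)"
      by (simp add: rotate_rotate)
    also have "\<dots> = \<phi> (inverse u * u', v)"
      by (simp add: * rotate_tube)
    also have "\<dots> \<in> \<phi> ` (sphere 0 1 \<times> ball 0 1)"
      using * assms(1) by (intro imageI) (simp add: norm_mult norm_inverse)
    finally show False
      using assms(2) by (simp add: knot_exterior_def)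
  qed
  with sphere show ?thesis
    by (simp add: knot_exterior_def)
qed

text \<open>The circle action moves a loop \<open>g\<close> around the fibre through its base point; the two ways
  around the square \<open>(s, t) \<mapsto> rotate s (g t)\<close> show that \<open>g\<close> commutes with the fibre.\<close>

lemma fibre_central:
  assumes "g \<in> carrier G"
  shows "torus_class 1 0 \<otimes>\<^bsub>G\<^esub> g = g \<otimes>\<^bsub>G\<^esub> torus_class 1 0"
proof -
  obtain \<gamma> where \<gamma>: "\<gamma> \<in> loops_at E (\<phi> (1, 1))" "g = path_class E \<gamma>"
    using assms by (auto simp: knot_group_def fundamental_group_def)
  define Q where "Q = (\<lambda>(s, t). rotate (cis (2 * pi * s)) (\<gamma> t))"
  define fibre where "fibre = torus_map \<circ> linepath (0, 0) (of_int 1, of_int 0)"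
  have \<gamma>_cont: "continuous_on {0..1} \<gamma>" and \<gamma>_im: "\<And>t. t \<in> {0..1} \<Longrightarrow> \<gamma> t \<in> E"
    and ends: "\<gamma> 0 = \<phi> (1, 1)" "\<gamma> 1 = \<phi> (1, 1)"
    using \<gamma>(1) by (auto simp: loops_at_def path_def path_image_def pathstart_def pathfinish_def)
  have cont: "continuous_on ({0..1} \<times> {0..1}) Q"
    unfolding Q_def rotate_def case_prod_unfold
    by (intro continuous_intros continuous_on_compose2[OF \<gamma>_cont]) auto
  have image: "Q \<in> {0..1} \<times> {0..1} \<rightarrow> E"
    using \<gamma>_im by (auto simp: Q_def intro!: rotate_exterior)
  have seg: "closed_segment a b \<subseteq> {0..1} \<times> {0..1}" if "a \<in> {0..1} \<times> {0..1}" "b \<in> {0..1} \<times> {0..1}"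
    for a b :: "real \<times> real"
    using that by (intro closed_segment_subset convex_Times) auto
  have sub: "closed_segment ((linepath a b +++ linepath b c) t) ((linepath a d +++ linepath d c) t)
      \<subseteq> {0..1} \<times> {0..1}"
    if "a \<in> {0..1} \<times> {0..1}" "b \<in> {0..1} \<times> {0..1}" "c \<in> {0..1} \<times> {0..1}" "d \<in> {0..1} \<times> {0..1}" "t \<in> {0..1}"
    for a b c d :: "real \<times> real" and t
  proof (rule seg)
    have *: "path_image (linepath a e +++ linepath e c) \<subseteq> {0..1} \<times> {0..1}"
      if "e \<in> {0..1} \<times> {0..1}" for e
      using seg that \<open>a \<in> _\<close> \<open>c \<in> _\<close> by (auto simp: path_image_join)
    show "(linepath a b +++ linepath b c) t \<in> {0..1} \<times> {0..1}"
      "(linepath a d +++ linepath d c) t \<in> {0..1} \<times> {0..1}"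
      using *[OF that(2)] *[OF that(4)] that(5) unfolding path_image_def by blast+
  qed
  have "homotopic_paths ({0..1} \<times> {0..1})
      (linepath (0, 0) (1, 0) +++ linepath (1, 0) (1, 1))
      (linepath (0, 0) (0, 1) +++ linepath (0, 1) (1, 1 :: real) :: real \<Rightarrow> real \<times> real)"
  proof (rule homotopic_paths_linear)
    show "closed_segment ((linepath (0, 0) (1, 0) +++ linepath (1, 0) (1, 1)) t)
        ((linepath (0, 0) (0, 1) +++ linepath (0, 1) (1, 1)) t) \<subseteq> {0..1::real} \<times> {0..1::real}"
      if "t \<in> {0..1}" for t
      by (rule sub) (use that in auto)
  qed auto
  then have "homotopic_paths E (Q \<circ> (linepath (0, 0) (1, 0) +++ linepath (1, 0) (1, 1)))
      (Q \<circ> (linepath (0, 0) (0, 1) +++ linepath (0, 1) (1, 1)))"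
    using cont image by (rule homotopic_paths_continuous_image)
  moreover have "Q \<circ> linepath (0, 0) (1, 0) = fibre" "Q \<circ> linepath (0, 1) (1, 1) = fibre"
    "Q \<circ> linepath (1, 0) (1, 1) = \<gamma>" "Q \<circ> linepath (0, 0) (0, 1) = \<gamma>"
    by (auto simp: Q_def fibre_def torus_map_def linepath_def rotate_tube ends)
  ultimately have "homotopic_paths E (fibre +++ \<gamma>) (\<gamma> +++ fibre)"
    by (simp add: path_compose_join)
  moreover have "fibre \<in> loops_at E (\<phi> (1, 1))"
    unfolding fibre_def by (rule torus_loop)
  ultimately show ?thesis
    unfolding torus_class_def fibre_def[symmetric] \<gamma>(2)
    using \<gamma>(1) by (simp add: knot_group_def mult_fundamental_group path_class_eqI)
qed


section \<open>Linking numbers\<close>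

text \<open>With the factor \<open>sqrt 2\<close> the knot is parametrised by
  \<open>(u ^ p, u ^ q)\<close> in the coordinates \<open>cz\<close> and \<open>cw\<close>.\<close>

definition cz :: "complex \<times> complex \<Rightarrow> complex" where "cz x = of_real (sqrt 2) * fst x"

definition cw :: "complex \<times> complex \<Rightarrow> complex" where "cw x = of_real (sqrt 2) * snd x"

lemma continuous_on_cz [continuous_intros]:
  "continuous_on S f \<Longrightarrow> continuous_on S (\<lambda>x. cz (f x))"
  unfolding cz_def by (intro continuous_intros)

lemma continuous_on_cw [continuous_intros]:
  "continuous_on S f \<Longrightarrow> continuous_on S (\<lambda>x. cw (f x))"
  unfolding cw_def by (intro continuous_intros)

text \<open>A zero of the knot equation on the sphere lies on the knot. Equal powers put both moduli
  on the same side of 1, and their squares sum to 2, so both are 1; the parameter u is then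
  recovered by Bezout exponents.\<close>

lemma exterior_coords: "x \<in> E \<Longrightarrow> cz x ^ q \<noteq> cw x ^ p"
proof
  assume x: "x \<in> E" and eq: "cz x ^ q = cw x ^ p"
  have "norm x = 1"
    using x by (simp add: knot_exterior_def)
  then have "norm (fst x) ^ 2 + norm (snd x) ^ 2 = 1"
    by (cases x) (simp add: norm_Pair)
  then have sum: "norm (cz x) ^ 2 + norm (cw x) ^ 2 = 2"
    by (simp add: cz_def cw_def norm_mult power_mult_distrib)
  have neq: "norm (cz x) ^ q = norm (cw x) ^ p"
    using arg_cong[OF eq, of norm] by (simp add: norm_power)
  have "norm (cz x) = 1"
  proof (rule linorder_cases[of "norm (cz x)" 1])
    assume less: "norm (cz x) < 1"
    then have "norm (cw x) ^ p < 1 ^ p"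
      using q neq by (simp add: power_less_one_iff flip: neq)
    then have "norm (cw x) < 1"
      using power_less_imp_less_base by fastforce
    then have "norm (cz x) ^ 2 < 1" "norm (cw x) ^ 2 < 1"
      using less by (simp_all add: power_less_one_iff)
    then show ?thesis
      using sum by simp
  next
    assume less: "norm (cz x) > 1"
    then have "norm (cw x) ^ p > 1 ^ p"
      using q by (simp flip: neq)
    then have "norm (cw x) > 1"
      using power_less_imp_less_base by fastforce
    then have "norm (cz x) ^ 2 > 1" "norm (cw x) ^ 2 > 1"
      using less by simp_all
    then show ?thesis
      using sum by simp
  qed
  moreover have "norm (cw x) \<noteq> - 1"
    using norm_ge_zero[of "cw x"] by linarith
  ultimately have norm: "norm (cz x) = 1" "norm (cw x) = 1"
    using sum by (auto simp: power2_eq_1_iff)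
  then have nz: "cz x \<noteq> 0" "cw x \<noteq> 0"
    by auto
  obtain m n where mn: "m * int p + n * int q = 1"
    using bezout_int[of "int p" "int q"] coprime by auto
  define u where "u = cz x powi m * cw x powi n"
  have "u ^ p = cz x powi (m * int p) * (cw x ^ p) powi n"
    unfolding u_def power_mult_distrib power_int_power power_int_power' by (simp only: mult.commute)
  also have "\<dots> = cz x powi (m * int p + n * int q)"
    using nz by (simp add: power_int_add power_int_power mult.commute flip: eq)
  finally have up: "u ^ p = cz x"
    by (simp add: mn)
  have "u ^ q = (cz x ^ q) powi m * cw x powi (n * int q)"
    unfolding u_def power_mult_distrib power_int_power power_int_power' by (simp only: mult.commute)
  also have "\<dots> = cw x powi (m * int p + n * int q)"
    using nz by (simp add: eq power_int_add power_int_power mult.commute)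
  finally have uq: "u ^ q = cw x"
    by (simp add: mn)
  have "x = (u ^ p / of_real (sqrt 2), u ^ q / of_real (sqrt 2))"
    unfolding up uq cz_def cw_def by (simp add: prod_eq_iff)
  moreover have "u \<in> sphere 0 1"
    by (simp add: u_def norm_mult norm_power_int norm)
  ultimately have "x \<in> torus_knot p q"
    unfolding torus_knot_def by blast
  then have "x \<in> \<phi> ` (sphere 0 1 \<times> ball 0 1)"
    unfolding torus_knot_tube_core[symmetric] by force
  then show False
    using x by (simp add: knot_exterior_def)
qed

section \<open>Moduli and arguments of the two coordinates on the tube\<close>

definition rz :: "real \<Rightarrow> real" where "rz y = sqrt 2 * sin (pi / 4 + y / 2)"

definition rw :: "real \<Rightarrow> real" where "rw y = sqrt 2 * cos (pi / 4 + y / 2)"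

definition N :: real where "N = real p ^ 2 + real q ^ 2"

definition \<kappa> :: real where "\<kappa> = real p ^ 2 / N"

lemma N_pos: "N > 0"
  using p by (simp add: N_def add_pos_nonneg)

lemma radii_pos: "\<bar>y\<bar> \<le> 1 \<Longrightarrow> rz y > 0" "\<bar>y\<bar> \<le> 1 \<Longrightarrow> rw y > 0"
  using pi_gt3 unfolding rz_def rw_def
  by (auto intro!: mult_pos_pos sin_gt_zero cos_gt_zero_pi)

lemma radii_square: "rz y ^ 2 = 1 + sin y" "rw y ^ 2 = 1 - sin y"
proof -
  define x where "x = pi / 4 + y / 2"
  have "cos (2 * x) = - sin y"
    by (simp add: x_def distrib_left cos_add)
  then have "2 * sin x ^ 2 = 1 + sin y" "2 * cos x ^ 2 = 1 - sin y"
    using cos_double_sin[of x] cos_double_cos[of x] by simp_all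
  then show "rz y ^ 2 = 1 + sin y" "rw y ^ 2 = 1 - sin y"
    by (simp_all add: rz_def rw_def power_mult_distrib x_def)
qed

lemma radii_zero: "rz 0 = 1" "rw 0 = 1"
  by (simp_all add: rz_def rw_def sin_45 cos_45)

lemma radii_less:
  "0 < y \<Longrightarrow> y \<le> 1 \<Longrightarrow> rw y ^ p < rz y ^ q"
  "y < 0 \<Longrightarrow> - 1 \<le> y \<Longrightarrow> rz y ^ q < rw y ^ p"
proof -
  have gt: "a > 1" if "a ^ 2 > 1" "a > 0" for a :: real
    using that power_less_imp_less_base[of 1 2 a] by simp
  have lt: "a < 1" if "a ^ 2 < 1" "a > 0" for a :: real
    using that power_less_imp_less_base[of a 2 1] by simp
  {
    assume y: "0 < y" "y \<le> 1"
    then have "sin y > 0"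
      using pi_gt3 by (intro sin_gt_zero) auto
    then have "rz y > 1" "rw y < 1" "rw y > 0"
      using y radii_pos[of y] radii_square[of y] gt[of "rz y"] lt[of "rw y"] by simp_all
    then have "rw y ^ p < 1" "1 < rz y ^ q"
      using p q by (auto simp: power_less_one_iff one_less_power)
    then show "rw y ^ p < rz y ^ q"
      by simp
  next
    assume y: "y < 0" "- 1 \<le> y"
    then have "sin (- y) > 0"
      using pi_gt3 by (intro sin_gt_zero) auto
    then have "rw y > 1" "rz y < 1" "rz y > 0"
      using y radii_pos[of y] radii_square[of y] gt[of "rw y"] lt[of "rz y"] by simp_all
    then have "rz y ^ q < 1" "1 < rw y ^ p"
      using p q by (auto simp: power_less_one_iff one_less_power)
    then show "rz y ^ q < rw y ^ p"
      by simp
  }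
qed

lemma cz_tube: "cz (\<phi> (u, v)) = of_real (rz (Im v)) * u ^ p * cis (- real q * Re v / N)"
  and cw_tube: "cw (\<phi> (u, v)) = of_real (rw (Im v)) * u ^ q * cis (real p * Re v / N)"
  by (simp_all add: cz_def cw_def torus_knot_tube_def rz_def rw_def N_def)

text \<open>Since \<open>q^2 / N = 1 - \<kappa>\<close>, the quotient of \<open>cz ^ q\<close> by
  \<open>cw ^ p\<close> on the tube has argument exactly - Re v. Together with
  \<open>radii_less\<close> this makes its position relative to 1 readable from v.\<close>

lemma cz_tube_power:
  "cz (\<phi> (u, v)) ^ q = of_real (rz (Im v) ^ q) * u ^ (p * q) * (cis (Re v * \<kappa>) * cis (- Re v))"
proof -
  have "real q * (- real q * Re v / N) = Re v * \<kappa> + - Re v"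
    using N_pos by (simp add: \<kappa>_def field_simps) (simp add: N_def algebra_simps power2_eq_square)
  then show ?thesis
    by (simp add: cz_tube power_mult_distrib Complex.DeMoivre power_mult cis_mult)
qed

lemma cw_tube_power:
  "cw (\<phi> (u, v)) ^ p = of_real (rw (Im v) ^ p) * u ^ (p * q) * cis (Re v * \<kappa>)"
proof -
  have "real p * (real p * Re v / N) = Re v * \<kappa>"
    by (simp add: \<kappa>_def power2_eq_square)
  then show ?thesis
    by (simp add: cw_tube power_mult_distrib Complex.DeMoivre power_mult mult.commute[of p q])
qed

text \<open>The rescaled polynomial z^q - w^p of the torus knot singularity; its winding number
  along a loop is the linking number with the knot.\<close>

definition milnor :: "complex \<times> complex \<Rightarrow> complex" where
  "milnor x = cz x ^ q - cw x ^ p"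

lemma continuous_on_milnor: "continuous_on S milnor"
  unfolding milnor_def by (intro continuous_intros)

lemma milnor_nonzero: "x \<in> E \<Longrightarrow> milnor x \<noteq> 0"
  using exterior_coords by (simp add: milnor_def)

lemma winding_number_milnor_meridian:
  "winding_number (milnor \<circ> (\<lambda>t. \<phi> (1, cis (2 * pi * t)))) 0 = 1"
proof -
  define c s where "c t = cos (2 * pi * t)" and "s t = sin (2 * pi * t)" for t
  \<comment> \<open>A straight-line homotopy to - \<i> times the unit circle, with the rotating
    prefactor ending at \<i>. It avoids 0: both imaginary parts have the sign of - c, and where c =
    0 both real parts have the sign of s.\<close>
  define K where "K = (\<lambda>(r, t). cis ((1 - r) * (c t * \<kappa>) + r * (pi / 2)) *
    (of_real (1 - r) * (of_real (rz (s t) ^ q) * cis (- c t) - of_real (rw (s t) ^ p))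
      + of_real r * (- \<i> * Complex (c t) (s t))))"
  have K_nz: "K (r, t) \<noteq> 0" if r: "r \<in> {0..1}" for r t
  proof
    assume "K (r, t) = 0"
    then have "of_real (1 - r) * (of_real (rz (s t) ^ q) * cis (- c t) - of_real (rw (s t) ^ p))
      + of_real r * (- \<i> * Complex (c t) (s t)) = 0"
      by (simp add: K_def)
    then have Re: "(1 - r) * (rz (s t) ^ q * cos (c t) - rw (s t) ^ p) + r * s t = 0"
      and Im: "(1 - r) * (rz (s t) ^ q * sin (c t)) + r * c t = 0"
      unfolding complex_eq_iff by (simp_all add: Re_power_real Im_power_real flip: of_real_power)
    have bounds: "\<bar>c t\<bar> \<le> 1" "\<bar>s t\<bar> \<le> 1" and sum: "c t ^ 2 + s t ^ 2 = 1"
      by (simp_all add: c_def s_def)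
    have rz: "rz (s t) ^ q > 0"
      using radii_pos bounds by simp
    have pos: "(1 - r) * (rz (s t) ^ q * sin x) + r * x > 0" if "0 < x" "x \<le> 1" for x
    proof (cases "r = 0")
      case False
      have "sin x > 0"
        using that pi_gt3 by (intro sin_gt_zero) auto
      then show ?thesis
        using r rz that False by (intro add_nonneg_pos) auto
    next
      case True
      have "sin x > 0"
        using that pi_gt3 by (intro sin_gt_zero) auto
      then show ?thesis
        using True rz by simp
    qed
    have "c t = 0"
    proof (rule linorder_cases[of "c t" 0])
      assume "c t > 0"
      then show ?thesis
        using pos[of "c t"] Im bounds by auto
    next
      assume "c t < 0"
      then show ?thesis
        using pos[of "- c t"] Im bounds by (auto simp: algebra_simps)
    qed
    then have "s t = 1 \<or> s t = - 1"
      using sum by (simp add: power2_eq_1_iff)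
    then show False
    proof
      assume s: "s t = 1"
      then have "rz (s t) ^ q - rw (s t) ^ p > 0"
        using radii_less(1)[of 1] by simp
      then have "(1 - r) * (rz (s t) ^ q - rw (s t) ^ p) + r > 0"
        using r by (cases "r = 0") (auto intro: add_nonneg_pos)
      then show False
        using Re \<open>c t = 0\<close> s by simp
    next
      assume s: "s t = - 1"
      then have "rw (s t) ^ p - rz (s t) ^ q > 0"
        using radii_less(2)[of "- 1"] by simp
      then have "(1 - r) * (rw (s t) ^ p - rz (s t) ^ q) + r > 0"
        using r by (cases "r = 0") (auto intro: add_nonneg_pos)
      then show False
        using Re \<open>c t = 0\<close> s by (simp add: algebra_simps)
    qed
  qed
  have per: "c 1 = c 0" "s 1 = s 0"
    by (simp_all add: c_def s_def)
  have "homotopic_loops (- {0}) (milnor \<circ> (\<lambda>t. \<phi> (1, cis (2 * pi * t)))) (\<lambda>t. cis (2 * pi * t))"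
    unfolding homotopic_loops
  proof (intro exI[of _ K] conjI ballI)
    show "continuous_on ({0..1} \<times> {0..1}) K"
      unfolding K_def case_prod_unfold c_def s_def rz_def rw_def Complex_eq
      by (auto intro!: continuous_intros)
    show "K \<in> {0..1} \<times> {0..1} \<rightarrow> - {0}"
      using K_nz by auto
    show "K (0, t) = (milnor \<circ> (\<lambda>t. \<phi> (1, cis (2 * pi * t)))) t" for t
      by (simp add: K_def milnor_def cz_tube_power cw_tube_power c_def s_def algebra_simps)
    show "K (1, t) = cis (2 * pi * t)" for t
      by (simp add: K_def c_def s_def complex_eq_iff)
    show "pathfinish (K \<circ> Pair r) = pathstart (K \<circ> Pair r)" for r
      by (simp add: pathfinish_def pathstart_def K_def per)
  qed
  then have "winding_number (milnor \<circ> (\<lambda>t. \<phi> (1, cis (2 * pi * t)))) 0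
      = winding_number (\<lambda>t. cis (2 * pi * t)) 0"
    by (rule winding_number_homotopic_loops)
  also have "\<dots> = winding_number (exp \<circ> linepath 0 (2 * of_real pi * \<i>)) 0"
    by (rule arg_cong[of _ _ "\<lambda>g. winding_number g 0"])
      (auto simp: linepath_def cis_conv_exp scaleR_conv_of_real mult_ac)
  also have "\<dots> = 1"
    by (subst winding_number_compose_exp) simp_all
  finally show ?thesis .
qed

text \<open>The polynomial is weighted homogeneous: along the fibre it is a nonzero constant times
  the pq-th power of the parameter.\<close>

lemma winding_number_milnor_fibre:
  "winding_number (milnor \<circ> (\<lambda>t. \<phi> (cis (2 * pi * t), 1))) 0 = of_nat (p * q)"
proof -
  define C where "C = milnor (\<phi> (1, 1))"
  have C: "C \<noteq> 0"
    by (simp add: C_def milnor_nonzero boundary_in_exterior)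
  have "(milnor \<circ> (\<lambda>t. \<phi> (cis (2 * pi * t), 1))) t
      = (exp \<circ> linepath (Ln C) (Ln C + 2 * of_real pi * \<i> * of_nat (p * q))) t" for t
  proof -
    have "(milnor \<circ> (\<lambda>t. \<phi> (cis (2 * pi * t), 1))) t = C * cis (2 * pi * t) ^ (p * q)"
      by (simp add: C_def milnor_def cz_tube_power cw_tube_power algebra_simps)
    also have "cis (2 * pi * t) ^ (p * q) = exp (of_real t * (2 * of_real pi * \<i> * of_nat (p * q)))"
      unfolding Complex.DeMoivre by (simp add: cis_conv_exp mult_ac)
    also have "C * \<dots> = exp (Ln C + of_real t * (2 * of_real pi * \<i> * of_nat (p * q)))"
      using C by (simp add: exp_add)
    also have "Ln C + of_real t * (2 * of_real pi * \<i> * of_nat (p * q))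
        = linepath (Ln C) (Ln C + 2 * of_real pi * \<i> * of_nat (p * q)) t"
      by (simp add: linepath_def scaleR_conv_of_real algebra_simps)
    finally show ?thesis
      by simp
  qed
  then have "milnor \<circ> (\<lambda>t. \<phi> (cis (2 * pi * t), 1))
      = exp \<circ> linepath (Ln C) (Ln C + 2 * of_real pi * \<i> * of_nat (p * q))"
    by blast
  then show ?thesis
    by (simp only:) (subst winding_number_compose_exp, simp_all)
qed

lemma linking_number:
  obtains lk :: "(real \<Rightarrow> complex \<times> complex) set \<Rightarrow> int"
  where "\<And>x y. x \<in> carrier G \<Longrightarrow> y \<in> carrier G \<Longrightarrow> lk (x \<otimes>\<^bsub>G\<^esub> y) = lk x + lk y"
    "lk (torus_class 0 1) = 1" "lk (torus_class 1 0) = int (p * q)"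
proof -
  let ?a = "\<phi> (1, 1)"
  \<comment> \<open>The floor only converts the type: winding numbers of closed paths are
    integers.\<close>
  define lk where "lk X = \<lfloor>Re (winding_number (milnor \<circ> (SOME g. g \<in> X)) 0)\<rfloor>"
    for X :: "(real \<Rightarrow> complex \<times> complex) set"
  have path: "path (milnor \<circ> g)" "0 \<notin> path_image (milnor \<circ> g)"
    "pathfinish (milnor \<circ> g) = pathstart (milnor \<circ> g)" if "g \<in> loops_at E ?a" for g
    using that milnor_nonzero
    by (auto simp: loops_at_def path_image_compose pathfinish_compose pathstart_compose
        intro!: path_continuous_image continuous_on_milnor)
  have lk: "of_int (lk (path_class E g)) = winding_number (milnor \<circ> g) 0"
    if g: "g \<in> loops_at E ?a" for g
  proof -
    have "g \<in> path_class E g"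
      using g by (auto simp: path_class_def loops_at_def)
    then have "(SOME g'. g' \<in> path_class E g) \<in> path_class E g"
      by (rule someI[of "\<lambda>g'. g' \<in> path_class E g"])
    then have "homotopic_paths E g (SOME g'. g' \<in> path_class E g)"
      by (simp add: path_class_def)
    then have "homotopic_paths (- {0}) (milnor \<circ> g) (milnor \<circ> (SOME g'. g' \<in> path_class E g))"
      by (rule homotopic_paths_continuous_image) (auto simp: continuous_on_milnor milnor_nonzero)
    then have "winding_number (milnor \<circ> (SOME g'. g' \<in> path_class E g)) 0
        = winding_number (milnor \<circ> g) 0"
      by (simp add: winding_number_homotopic_paths)
    moreover have "winding_number (milnor \<circ> g) 0 \<in> \<int>"
      using path[OF g] by (intro integer_winding_number)
    ultimately show ?thesis
      unfolding lk_def by (auto elim!: Ints_cases)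
  qed
  show thesis
  proof (rule that)
    fix x y assume "x \<in> carrier G" "y \<in> carrier G"
    then obtain g h where gh: "g \<in> loops_at E ?a" "h \<in> loops_at E ?a"
      "x = path_class E g" "y = path_class E h"
      by (auto simp: knot_group_def fundamental_group_def)
    have "winding_number (milnor \<circ> (g +++ h)) 0
        = winding_number (milnor \<circ> g) 0 + winding_number (milnor \<circ> h) 0"
      unfolding path_compose_join using gh path
      by (intro winding_number_join) (auto simp: loops_at_def pathfinish_compose pathstart_compose)
    then have "(of_int (lk (x \<otimes>\<^bsub>G\<^esub> y)) :: complex) = of_int (lk x + lk y)"
      using gh by (simp add: knot_group_def mult_fundamental_group lk loops_at_join)
    then show "lk (x \<otimes>\<^bsub>G\<^esub> y) = lk x + lk y"
      by (simp only: of_int_eq_iff)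
  next
    have "torus_map \<circ> linepath (0, 0) (of_int 0, of_int 1) = (\<lambda>t. \<phi> (1, cis (2 * pi * t)))"
      by (auto simp: torus_map_def linepath_def cis_zero)
    then have "(of_int (lk (torus_class 0 1)) :: complex) = of_int 1"
      using lk[OF torus_loop[of 0 1]] winding_number_milnor_meridian
      by (simp add: torus_class_def)
    then show "lk (torus_class 0 1) = 1"
      by (simp only: of_int_eq_iff)
    have "torus_map \<circ> linepath (0, 0) (of_int 1, of_int 0) = (\<lambda>t. \<phi> (cis (2 * pi * t), 1))"
      by (auto simp: torus_map_def linepath_def cis_zero)
    then have "(of_int (lk (torus_class 1 0)) :: complex) = of_int (int (p * q))"
      using lk[OF torus_loop[of 1 0]] winding_number_milnor_fibre
      by (simp add: torus_class_def)
    then show "lk (torus_class 1 0) = int (p * q)"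
      by (simp only: of_int_eq_iff)
  qed
qed

end


section \<open>Representations of torus knot groups\<close>

lemma cis_eq_imp:
  assumes "cis s = cis t"
  shows "of_int \<lfloor>(s - t) / (2 * pi)\<rfloor> * (2 * pi) = s - t"
proof -
  have "cis (s - t) = 1"
    using assms by (simp flip: cis_divide)
  then have "cos (s - t) = 1"
    by (simp add: complex_eq_iff)
  then obtain n :: int where "s - t = of_int n * (2 * pi)"
    using cos_one_2pi_int[of "s - t"] by (auto simp: mult.assoc)
  then show ?thesis
    by simp
qed

text \<open>Integers whose multiples by 2 pi vary continuously cannot jump; this is the only source
  of local constancy for the charts.\<close>

lemma eventually_int_constant:
  assumes "\<forall>\<^sub>F y in nhds x. y \<in> S \<longrightarrow> of_int (n y) * (2 * pi) = (g y :: real)"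
    and "continuous (at x within S) g" "x \<in> S"
  shows "\<forall>\<^sub>F y in nhds x. y \<in> S \<longrightarrow> (n y :: int) = n x"
proof -
  have "\<forall>\<^sub>F y in at x within S. dist (g y) (g x) < 2 * pi"
    using assms(2) unfolding continuous_within by (rule tendstoD) simp
  then have "\<forall>\<^sub>F y in nhds x. y \<in> S \<longrightarrow> dist (g y) (g x) < 2 * pi"
    unfolding eventually_at_filter by (rule eventually_mono) auto
  with assms(1) show ?thesis
  proof eventually_elim
    case (elim y)
    show ?case
    proof
      assume y: "y \<in> S"
      have "of_int (n x) * (2 * pi) = g x"
        using assms(1,3) eventually_nhds_x_imp_x by blast
      then have "\<bar>of_int (n y - n x) * (2 * pi)\<bar> < 2 * pi"
        using elim y by (simp add: dist_real_def left_diff_distrib)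
      then have "\<bar>of_int (n y - n x)\<bar> < (1 :: real)"
        by (simp add: abs_mult)
      then show "n y = n x"
        by linarith
    qed
  qed
qed

text \<open>How many turns separate \<open>Arg z\<close> from the branch of the argument cut along
  the ray opposite to \<omega>.\<close>

definition arg_shift :: "complex \<Rightarrow> complex \<Rightarrow> int" where
  "arg_shift \<omega> z = \<lfloor>(Arg (z / \<omega>) + Arg \<omega> - Arg z) / (2 * pi)\<rfloor>"

lemma arg_shift:
  assumes "z \<noteq> 0" "\<omega> \<noteq> 0"
  shows "of_int (arg_shift \<omega> z) * (2 * pi) = Arg (z / \<omega>) + Arg \<omega> - Arg z"
  unfolding arg_shift_def
proof (rule cis_eq_imp)
  have "cis (Arg (z / \<omega>) + Arg \<omega>) = sgn (z / \<omega>) * sgn \<omega>"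
    using assms by (simp add: cis_Arg flip: cis_mult)
  also have "\<dots> = cis (Arg z)"
    using assms by (simp add: cis_Arg sgn_div_norm field_simps norm_divide scaleR_conv_of_real)
  finally show "cis (Arg (z / \<omega>) + Arg \<omega>) = cis (Arg z)" .
qed

context torus_knot_exterior
begin

text \<open>The solid tori \<open>cw\<^sup>p / cz\<^sup>q \<notin> [1, \<infinity>)\<close> and \<open>cz\<^sup>q / cw\<^sup>p \<notin> [1, \<infinity>)\<close>, written without division.\<close>

definition torus_z :: "(complex \<times> complex) set" where
  "torus_z = {x \<in> E. (cw x ^ p - cz x ^ q) * cnj (cz x ^ q) \<notin> \<real>\<^sub>\<ge>\<^sub>0}"

definition torus_w :: "(complex \<times> complex) set" where
  "torus_w = {x \<in> E. (cz x ^ q - cw x ^ p) * cnj (cw x ^ p) \<notin> \<real>\<^sub>\<ge>\<^sub>0}"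

text \<open>A vanishing coordinate makes the defining product 0, which counts as a nonnegative real
  and is thus excluded.\<close>

lemma cz_nonzero: "x \<in> torus_z \<Longrightarrow> cz x \<noteq> 0"
  and cw_nonzero: "x \<in> torus_w \<Longrightarrow> cw x \<noteq> 0"
  using p q by (auto simp: torus_z_def torus_w_def power_0_left)

text \<open>If both defining products were nonnegative, so would be their sum, which is minus the
  squared modulus of \<open>cz x ^ q - cw x ^ p\<close>; but this difference is nonzero on the
  exterior.\<close>

lemma exterior_cover:
  assumes "x \<in> E"
  shows "x \<in> torus_z \<or> x \<in> torus_w"
proof (rule ccontr)
  assume "\<not> ?thesis"
  then have "(cw x ^ p - cz x ^ q) * cnj (cz x ^ q) \<in> \<real>\<^sub>\<ge>\<^sub>0"
    "(cz x ^ q - cw x ^ p) * cnj (cw x ^ p) \<in> \<real>\<^sub>\<ge>\<^sub>0"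
    using assms by (auto simp: torus_z_def torus_w_def)
  then have "(cw x ^ p - cz x ^ q) * cnj (cz x ^ q)
      + (cz x ^ q - cw x ^ p) * cnj (cw x ^ p) \<in> \<real>\<^sub>\<ge>\<^sub>0"
    by (rule nonneg_Reals_add_I)
  also have "(cw x ^ p - cz x ^ q) * cnj (cz x ^ q) + (cz x ^ q - cw x ^ p) * cnj (cw x ^ p)
      = - ((cz x ^ q - cw x ^ p) * cnj (cz x ^ q - cw x ^ p))"
    by (simp add: algebra_simps)
  also have "\<dots> = of_real (- (norm (cz x ^ q - cw x ^ p) ^ 2))"
    by (simp only: of_real_minus complex_norm_square)
  finally have "norm (cz x ^ q - cw x ^ p) ^ 2 \<le> 0"
    unfolding nonneg_Reals_of_real_iff by simp
  then show False
    using exterior_coords[OF assms] by simp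
qed

text \<open>If \<open>a * cnj b\<close> were a real r \<ge> 0, the two tori would give r < |a|^2 and
  r < |b|^2, whereas r = |a| |b|. The minus sign moves the excluded ray to the cut of
  \<open>Arg\<close>.\<close>

lemma overlap_arg:
  assumes "x \<in> torus_z" "x \<in> torus_w"
  shows "- (cz x ^ q * cnj (cw x ^ p)) \<notin> \<real>\<^sub>\<le>\<^sub>0"
proof
  define a b where "a = cz x ^ q" and "b = cw x ^ p"
  assume "- (cz x ^ q * cnj (cw x ^ p)) \<in> \<real>\<^sub>\<le>\<^sub>0"
  then have "a * cnj b \<in> \<real>\<^sub>\<ge>\<^sub>0"
    by (simp add: a_def b_def)
  then obtain r where r: "r \<ge> 0" "a * cnj b = of_real r"
    by (auto elim!: nonneg_Reals_cases)
  have "b * cnj a = cnj (a * cnj b)"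
    by (simp add: mult.commute)
  then have r': "b * cnj a = of_real r"
    by (simp only: r(2) complex_cnj_complex_of_real)
  have eq_a: "(b - a) * cnj a = of_real (r - norm a ^ 2)"
    by (simp only: of_real_diff complex_norm_square left_diff_distrib r')
  have "(b - a) * cnj a \<notin> \<real>\<^sub>\<ge>\<^sub>0"
    using assms(1) by (simp add: torus_z_def a_def b_def)
  then have 1: "r < norm a ^ 2"
    unfolding eq_a nonneg_Reals_of_real_iff by simp
  have eq_b: "(a - b) * cnj b = of_real (r - norm b ^ 2)"
    by (simp only: of_real_diff complex_norm_square left_diff_distrib r(2))
  have "(a - b) * cnj b \<notin> \<real>\<^sub>\<ge>\<^sub>0"
    using assms(2) by (simp add: torus_w_def a_def b_def)
  then have 2: "r < norm b ^ 2"
    unfolding eq_b nonneg_Reals_of_real_iff by simp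
  have "norm a * norm b = r"
    using arg_cong[OF r(2), of norm] r(1) by (simp add: norm_mult)
  then have "r * r = norm a ^ 2 * norm b ^ 2"
    by (metis power2_eq_square power_mult_distrib)
  moreover have "r * r < norm a ^ 2 * norm b ^ 2"
    using 1 2 r(1) by (intro mult_strict_mono') auto
  ultimately show False
    by simp
qed

text \<open>
  On the overlap of the two solid tori, \<open>cz\<^sup>q / cw\<^sup>p\<close> avoids \<open>[0, \<infinity>)\<close> and so has a
  continuous argument \<open>\<theta>\<close> between \<open>0\<close> and \<open>2\<pi>\<close>. The integer \<open>J\<close> measures by how much the principal
  arguments \<open>\<alpha>\<close> of \<open>cz\<close> and \<open>\<beta>\<close> of \<open>cw\<close> fail to satisfy \<open>q \<alpha> - p \<beta> = \<theta>\<close>. It is locally constant up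
  to the jumps of \<open>\<alpha>\<close> and \<open>\<beta>\<close>, which change it by multiples of \<open>q\<close> and \<open>p\<close>; hence \<open>P\<^sup>J\<close> and
  \<open>Q\<^sup>-\<^sup>J\<close>, corrected by these jumps on one torus each, are the charts of a flat atlas.
\<close>

definition J :: "complex \<times> complex \<Rightarrow> int" where
  "J x = \<lfloor>((real q * Arg (cz x) - real p * Arg (cw x))
     - (Arg (- (cz x ^ q * cnj (cw x ^ p))) + pi)) / (2 * pi)\<rfloor>"

lemma J_eq:
  assumes "cz x \<noteq> 0" "cw x \<noteq> 0"
  shows "of_int (J x) * (2 * pi) = real q * Arg (cz x) - real p * Arg (cw x)
    - (Arg (- (cz x ^ q * cnj (cw x ^ p))) + pi)"
  unfolding J_def
proof (rule cis_eq_imp)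
  have sgn_power: "sgn (z ^ n) = sgn z ^ n" for z :: complex and n
    by (induction n) (simp_all add: Real_Vector_Spaces.sgn_mult)
  have sgn_cnj: "sgn (cnj z) = inverse (sgn z)" if "z \<noteq> 0" for z
  proof -
    have "of_real (norm z) * of_real (norm z) = z * cnj z"
      using complex_norm_square[of z] by (simp add: power2_eq_square)
    then show ?thesis
      using that by (simp add: sgn_div_norm scaleR_conv_of_real field_simps)
  qed
  have "cis (real q * Arg (cz x) - real p * Arg (cw x))
      = cis (Arg (cz x)) ^ q / cis (Arg (cw x)) ^ p"
    by (simp add: Complex.DeMoivre cis_divide)
  also have "\<dots> = sgn (cz x ^ q) * inverse (sgn (cw x ^ p))"
    using assms by (simp add: cis_Arg sgn_power divide_inverse)
  also have "\<dots> = sgn (cz x ^ q * cnj (cw x ^ p))"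
    using assms by (simp add: Real_Vector_Spaces.sgn_mult sgn_cnj del: complex_cnj_power)
  also have "\<dots> = - sgn (- (cz x ^ q * cnj (cw x ^ p)))"
    by (simp only: sgn_minus minus_minus)
  also have "\<dots> = cis (Arg (- (cz x ^ q * cnj (cw x ^ p))) + pi)"
    using assms by (subst cis_Arg[symmetric]) (simp_all add: minus_cis)
  finally show "cis (real q * Arg (cz x) - real p * Arg (cw x))
      = cis (Arg (- (cz x ^ q * cnj (cw x ^ p))) + pi)" .
qed

section \<open>The flat atlas on the exterior\<close>

definition chart_index :: "(bool \<times> complex) set" where
  "chart_index = UNIV \<times> (- {0})"

text \<open>The index \<omega> selects a branch of the argument; the ray opposite to \<omega> is
  removed so that this branch is continuous on the domain.\<close>

fun chart_domain :: "bool \<times> complex \<Rightarrow> (complex \<times> complex) set" where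
  "chart_domain (True, \<omega>) = {x \<in> torus_z. cz x / \<omega> \<notin> \<real>\<^sub>\<le>\<^sub>0}"
| "chart_domain (False, \<omega>) = {x \<in> torus_w. cw x / \<omega> \<notin> \<real>\<^sub>\<le>\<^sub>0}"

lemma open_chart_domain: "openin (top_of_set E) (chart_domain i)"
proof -
  have open_z: "open {x. (cw x ^ p - cz x ^ q) * cnj (cz x ^ q) \<notin> \<real>\<^sub>\<ge>\<^sub>0 \<and> cz x / \<omega> \<notin> \<real>\<^sub>\<le>\<^sub>0}"
    for \<omega>
  proof -
    have "continuous_on UNIV (\<lambda>x. (cw x ^ p - cz x ^ q) * cnj (cz x ^ q))"
      "continuous_on UNIV (\<lambda>x. cz x * inverse \<omega>)"
      by (intro continuous_intros)+
    then have "open ((\<lambda>x. (cw x ^ p - cz x ^ q) * cnj (cz x ^ q)) -` (- \<real>\<^sub>\<ge>\<^sub>0))"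
      "open ((\<lambda>x. cz x * inverse \<omega>) -` (- \<real>\<^sub>\<le>\<^sub>0))"
      by (auto intro!: open_vimage)
    then have "open ((\<lambda>x. (cw x ^ p - cz x ^ q) * cnj (cz x ^ q)) -` (- \<real>\<^sub>\<ge>\<^sub>0)
        \<inter> (\<lambda>x. cz x * inverse \<omega>) -` (- \<real>\<^sub>\<le>\<^sub>0))"
      by (rule open_Int)
    also have "\<dots> = {x. (cw x ^ p - cz x ^ q) * cnj (cz x ^ q) \<notin> \<real>\<^sub>\<ge>\<^sub>0 \<and> cz x / \<omega> \<notin> \<real>\<^sub>\<le>\<^sub>0}"
      by (auto simp: divide_inverse)
    finally show ?thesis .
  qed
  have open_w: "open {x. (cz x ^ q - cw x ^ p) * cnj (cw x ^ p) \<notin> \<real>\<^sub>\<ge>\<^sub>0 \<and> cw x / \<omega> \<notin> \<real>\<^sub>\<le>\<^sub>0}"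
    for \<omega>
  proof -
    have "continuous_on UNIV (\<lambda>x. (cz x ^ q - cw x ^ p) * cnj (cw x ^ p))"
      "continuous_on UNIV (\<lambda>x. cw x * inverse \<omega>)"
      by (intro continuous_intros)+
    then have "open ((\<lambda>x. (cz x ^ q - cw x ^ p) * cnj (cw x ^ p)) -` (- \<real>\<^sub>\<ge>\<^sub>0))"
      "open ((\<lambda>x. cw x * inverse \<omega>) -` (- \<real>\<^sub>\<le>\<^sub>0))"
      by (auto intro!: open_vimage)
    then have "open ((\<lambda>x. (cz x ^ q - cw x ^ p) * cnj (cw x ^ p)) -` (- \<real>\<^sub>\<ge>\<^sub>0)
        \<inter> (\<lambda>x. cw x * inverse \<omega>) -` (- \<real>\<^sub>\<le>\<^sub>0))"
      by (rule open_Int)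
    also have "\<dots> = {x. (cz x ^ q - cw x ^ p) * cnj (cw x ^ p) \<notin> \<real>\<^sub>\<ge>\<^sub>0 \<and> cw x / \<omega> \<notin> \<real>\<^sub>\<le>\<^sub>0}"
      by (auto simp: divide_inverse)
    finally show ?thesis .
  qed
  obtain b \<omega> where i: "i = (b, \<omega>)"
    by force
  have "chart_domain i = E \<inter> (if b
      then {x. (cw x ^ p - cz x ^ q) * cnj (cz x ^ q) \<notin> \<real>\<^sub>\<ge>\<^sub>0 \<and> cz x / \<omega> \<notin> \<real>\<^sub>\<le>\<^sub>0}
      else {x. (cz x ^ q - cw x ^ p) * cnj (cw x ^ p) \<notin> \<real>\<^sub>\<ge>\<^sub>0 \<and> cw x / \<omega> \<notin> \<real>\<^sub>\<le>\<^sub>0})"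
    by (cases b) (auto simp: i torus_z_def torus_w_def)
  then show ?thesis
    using open_z[of \<omega>] open_w[of \<omega>] by (auto intro: openin_open_Int)
qed

lemma eventually_chart_domain:
  assumes "x \<in> chart_domain i"
  shows "\<forall>\<^sub>F y in nhds x. y \<in> E \<longrightarrow> y \<in> chart_domain i"
proof -
  obtain T where T: "open T" "chart_domain i = E \<inter> T"
    using open_chart_domain[of i] by (auto simp: openin_open)
  then have "\<forall>\<^sub>F y in nhds x. y \<in> T"
    using assms by (intro eventually_nhds_in_open) auto
  then show ?thesis
    by eventually_elim (use T in auto)
qed

lemma continuous_Arg_compose:
  assumes "continuous_on UNIV f" "f x \<notin> \<real>\<^sub>\<le>\<^sub>0"
  shows "continuous (at x within S) (\<lambda>y. Arg (f y))"
proof -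
  have "isCont f x"
    using assms(1) by (simp add: continuous_on_eq_continuous_at)
  then have "isCont (\<lambda>y. Arg (f y)) x"
    by (rule isCont_o2) (rule continuous_at_Arg[OF assms(2)])
  then show ?thesis
    by (rule continuous_at_imp_continuous_within)
qed

lemma continuous_Arg_cz:
  "cz x / \<omega> \<notin> \<real>\<^sub>\<le>\<^sub>0 \<Longrightarrow> continuous (at x within S) (\<lambda>y. Arg (cz y / \<omega>))"
  unfolding divide_inverse by (rule continuous_Arg_compose) (auto intro!: continuous_intros)

lemma continuous_Arg_cw:
  "cw x / \<omega> \<notin> \<real>\<^sub>\<le>\<^sub>0 \<Longrightarrow> continuous (at x within S) (\<lambda>y. Arg (cw y / \<omega>))"
  unfolding divide_inverse by (rule continuous_Arg_compose) (auto intro!: continuous_intros)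

lemma eventually_arg_shift_cz:
  assumes "x \<in> chart_domain (True, \<omega>)" "x \<in> chart_domain (True, \<omega>')" "\<omega> \<noteq> 0" "\<omega>' \<noteq> 0"
  shows "\<forall>\<^sub>F y in nhds x. y \<in> E \<longrightarrow> arg_shift \<omega> (cz y) - arg_shift \<omega>' (cz y)
    = arg_shift \<omega> (cz x) - arg_shift \<omega>' (cz x)"
proof (rule eventually_int_constant)
  show "\<forall>\<^sub>F y in nhds x. y \<in> E \<longrightarrow>
      of_int (arg_shift \<omega> (cz y) - arg_shift \<omega>' (cz y)) * (2 * pi)
      = Arg (cz y / \<omega>) + Arg \<omega> - (Arg (cz y / \<omega>') + Arg \<omega>')"
    using eventually_chart_domain[OF assms(1)]
    by eventually_elim (use assms arg_shift cz_nonzero in \<open>auto simp: left_diff_distrib\<close>)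
  show "continuous (at x within E) (\<lambda>y. Arg (cz y / \<omega>) + Arg \<omega> - (Arg (cz y / \<omega>') + Arg \<omega>'))"
    using assms by (intro continuous_intros continuous_Arg_cz) auto
qed (use assms in \<open>auto simp: torus_z_def\<close>)

lemma eventually_arg_shift_cw:
  assumes "x \<in> chart_domain (False, \<omega>)" "x \<in> chart_domain (False, \<omega>')" "\<omega> \<noteq> 0" "\<omega>' \<noteq> 0"
  shows "\<forall>\<^sub>F y in nhds x. y \<in> E \<longrightarrow> arg_shift \<omega> (cw y) - arg_shift \<omega>' (cw y)
    = arg_shift \<omega> (cw x) - arg_shift \<omega>' (cw x)"
proof (rule eventually_int_constant)
  show "\<forall>\<^sub>F y in nhds x. y \<in> E \<longrightarrow>
      of_int (arg_shift \<omega> (cw y) - arg_shift \<omega>' (cw y)) * (2 * pi)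
      = Arg (cw y / \<omega>) + Arg \<omega> - (Arg (cw y / \<omega>') + Arg \<omega>')"
    using eventually_chart_domain[OF assms(1)]
    by eventually_elim (use assms arg_shift cw_nonzero in \<open>auto simp: left_diff_distrib\<close>)
  show "continuous (at x within E) (\<lambda>y. Arg (cw y / \<omega>) + Arg \<omega> - (Arg (cw y / \<omega>') + Arg \<omega>'))"
    using assms by (intro continuous_intros continuous_Arg_cw) auto
qed (use assms in \<open>auto simp: torus_w_def\<close>)

text \<open>The two shifts replace the principal arguments in \<open>J\<close> by the continuous
  branches at \<omega> and \<omega>', so 2 pi times the integer is a continuous function near
  x.\<close>

lemma eventually_J_overlap:
  assumes x: "x \<in> chart_domain (True, \<omega>)" "x \<in> chart_domain (False, \<omega>')" and "\<omega> \<noteq> 0" "\<omega>' \<noteq> 0"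
  shows "\<forall>\<^sub>F y in nhds x. y \<in> E \<longrightarrow>
    J y + int q * arg_shift \<omega> (cz y) - int p * arg_shift \<omega>' (cw y)
    = J x + int q * arg_shift \<omega> (cz x) - int p * arg_shift \<omega>' (cw x)"
proof (rule eventually_int_constant)
  show "\<forall>\<^sub>F y in nhds x. y \<in> E \<longrightarrow>
      of_int (J y + int q * arg_shift \<omega> (cz y) - int p * arg_shift \<omega>' (cw y)) * (2 * pi)
      = real q * (Arg (cz y / \<omega>) + Arg \<omega>) - real p * (Arg (cw y / \<omega>') + Arg \<omega>')
        - (Arg (- (cz y ^ q * cnj (cw y ^ p))) + pi)"
    using eventually_chart_domain[OF x(1)] eventually_chart_domain[OF x(2)]
  proof (eventually_elim, intro impI)
    fix y assume "y \<in> E \<longrightarrow> y \<in> chart_domain (True, \<omega>)" "y \<in> E \<longrightarrow> y \<in> chart_domain (False, \<omega>')"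
      "y \<in> E"
    then have nz: "cz y \<noteq> 0" "cw y \<noteq> 0"
      using cz_nonzero cw_nonzero by auto
    have "of_int (J y + int q * arg_shift \<omega> (cz y) - int p * arg_shift \<omega>' (cw y)) * (2 * pi)
        = of_int (J y) * (2 * pi) + real q * (of_int (arg_shift \<omega> (cz y)) * (2 * pi))
          - real p * (of_int (arg_shift \<omega>' (cw y)) * (2 * pi))"
      by (simp add: algebra_simps)
    also have "\<dots> = real q * (Arg (cz y / \<omega>) + Arg \<omega>) - real p * (Arg (cw y / \<omega>') + Arg \<omega>')
        - (Arg (- (cz y ^ q * cnj (cw y ^ p))) + pi)"
      unfolding J_eq[OF nz] arg_shift[OF nz(1) \<open>\<omega> \<noteq> 0\<close>] arg_shift[OF nz(2) \<open>\<omega>' \<noteq> 0\<close>]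
      by (simp add: algebra_simps)
    finally show "of_int (J y + int q * arg_shift \<omega> (cz y) - int p * arg_shift \<omega>' (cw y)) * (2 * pi)
      = real q * (Arg (cz y / \<omega>) + Arg \<omega>) - real p * (Arg (cw y / \<omega>') + Arg \<omega>')
        - (Arg (- (cz y ^ q * cnj (cw y ^ p))) + pi)" .
  qed
  have "continuous (at x within E) (\<lambda>y. Arg (- (cz y ^ q * cnj (cw y ^ p))))"
    using x overlap_arg by (intro continuous_Arg_compose continuous_intros) auto
  then show "continuous (at x within E) (\<lambda>y. real q * (Arg (cz y / \<omega>) + Arg \<omega>)
      - real p * (Arg (cw y / \<omega>') + Arg \<omega>') - (Arg (- (cz y ^ q * cnj (cw y ^ p))) + pi))"
    using x by (intro continuous_intros continuous_Arg_cz continuous_Arg_cw) auto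
qed (use x in \<open>auto simp: torus_z_def\<close>)

fun chart_value ::
  "('g, 'm) monoid_scheme \<Rightarrow> 'g \<Rightarrow> 'g \<Rightarrow> bool \<times> complex \<Rightarrow> complex \<times> complex \<Rightarrow> 'g" where
  "chart_value H P Q (True, \<omega>) x = P [^]\<^bsub>H\<^esub> (J x + int q * arg_shift \<omega> (cz x))"
| "chart_value H P Q (False, \<omega>) x = Q [^]\<^bsub>H\<^esub> (- J x + int p * arg_shift \<omega> (cw x))"

text \<open>Both exponents are plus or minus the locally constant integer of
  \<open>eventually_J_overlap\<close>, up to a multiple of p for \<open>P\<close> and of q for
  \<open>Q\<close>; the order relations absorb these multiples.\<close>

lemma chart_value_overlap:
  assumes "group H" and PQ: "P \<in> carrier H" "Q \<in> carrier H"
    and order: "P [^]\<^bsub>H\<^esub> p = \<one>\<^bsub>H\<^esub>" "Q [^]\<^bsub>H\<^esub> q = \<one>\<^bsub>H\<^esub>"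
    and x: "x \<in> chart_domain (True, \<omega>)" "x \<in> chart_domain (False, \<omega>')" and \<omega>: "\<omega> \<noteq> 0" "\<omega>' \<noteq> 0"
  shows "\<forall>\<^sub>F y in nhds x. y \<in> E \<longrightarrow>
    chart_value H P Q (True, \<omega>) y = chart_value H P Q (True, \<omega>) x \<and>
    chart_value H P Q (False, \<omega>') y = chart_value H P Q (False, \<omega>') x"
proof -
  interpret H: group H
    by fact
  define n where "n y = J y + int q * arg_shift \<omega> (cz y) - int p * arg_shift \<omega>' (cw y)" for y
  have period: "a [^]\<^bsub>H\<^esub> (k + int m * e) = a [^]\<^bsub>H\<^esub> k"
    if "a \<in> carrier H" "a [^]\<^bsub>H\<^esub> m = \<one>\<^bsub>H\<^esub>" for a k m e
    using that H.int_pow_pow[of a "int m" e] by (simp add: H.int_pow_mult int_pow_int)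
  have idx: "J y + int q * arg_shift \<omega> (cz y) = n y + int p * arg_shift \<omega>' (cw y)"
    "- J y + int p * arg_shift \<omega>' (cw y) = - n y + int q * arg_shift \<omega> (cz y)" for y
    by (simp_all add: n_def)
  have eq: "chart_value H P Q (True, \<omega>) y = P [^]\<^bsub>H\<^esub> n y"
    "chart_value H P Q (False, \<omega>') y = Q [^]\<^bsub>H\<^esub> (- n y)" for y
    by (simp_all only: chart_value.simps idx period[OF PQ(1) order(1)] period[OF PQ(2) order(2)])
  show ?thesis
    using eventually_J_overlap[OF x \<omega>] unfolding eq
    by eventually_elim (simp add: n_def)
qed

lemma flat_atlas_exterior:
  assumes "group H" and PQ: "P \<in> carrier H" "Q \<in> carrier H"
    and order: "P [^]\<^bsub>H\<^esub> p = \<one>\<^bsub>H\<^esub>" "Q [^]\<^bsub>H\<^esub> q = \<one>\<^bsub>H\<^esub>"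
  shows "flat_atlas H E chart_index chart_domain (chart_value H P Q)"
proof -
  interpret H: group H
    by fact
  show ?thesis
  proof
    show "openin (top_of_set E) (chart_domain i)" for i
      by (rule open_chart_domain)
    show "\<exists>i\<in>chart_index. x \<in> chart_domain i" if "x \<in> E" for x
      using exterior_cover[OF that]
    proof
      assume x: "x \<in> torus_z"
      then show ?thesis
        using cz_nonzero[OF x]
        by (intro bexI[of _ "(True, cz x)"]) (auto simp: chart_index_def)
    next
      assume x: "x \<in> torus_w"
      then show ?thesis
        using cw_nonzero[OF x]
        by (intro bexI[of _ "(False, cw x)"]) (auto simp: chart_index_def)
    qed
    show closed: "chart_value H P Q i x \<in> carrier H" for i x
      using PQ by (cases "(H, P, Q, i, x)" rule: chart_value.cases) auto
    have diff: "a [^]\<^bsub>H\<^esub> k \<otimes>\<^bsub>H\<^esub> inv\<^bsub>H\<^esub> (a [^]\<^bsub>H\<^esub> k') = a [^]\<^bsub>H\<^esub> (k - k')"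
      if "a \<in> carrier H" for a and k k' :: int
      using that by (simp add: H.int_pow_diff)
    fix i j x
    assume ij: "i \<in> chart_index" "j \<in> chart_index" and x: "x \<in> chart_domain i" "x \<in> chart_domain j"
    obtain b \<omega> b' \<omega>' where i: "i = (b, \<omega>)" and j: "j = (b', \<omega>')" and nz: "\<omega> \<noteq> 0" "\<omega>' \<noteq> 0"
      using ij by (auto simp: chart_index_def)
    show "\<forall>\<^sub>F y in nhds x. y \<in> E \<longrightarrow>
      chart_value H P Q i y \<otimes>\<^bsub>H\<^esub> inv\<^bsub>H\<^esub> chart_value H P Q j y
      = chart_value H P Q i x \<otimes>\<^bsub>H\<^esub> inv\<^bsub>H\<^esub> chart_value H P Q j x"
    proof (cases b; cases b')
      assume b: "b" "b'"
      \<comment> \<open>Between two charts of the same solid torus \<open>J\<close> cancels, so its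
        jumps away from the overlap do no harm.\<close>
      have "J y + int q * arg_shift \<omega> (cz y) - (J y + int q * arg_shift \<omega>' (cz y))
          = int q * (arg_shift \<omega> (cz y) - arg_shift \<omega>' (cz y))" for y
        by (simp add: algebra_simps)
      then have eq: "chart_value H P Q i y \<otimes>\<^bsub>H\<^esub> inv\<^bsub>H\<^esub> chart_value H P Q j y
          = P [^]\<^bsub>H\<^esub> (int q * (arg_shift \<omega> (cz y) - arg_shift \<omega>' (cz y)))" for y
        using b by (simp add: i j diff PQ)
      have "\<forall>\<^sub>F y in nhds x. y \<in> E \<longrightarrow> arg_shift \<omega> (cz y) - arg_shift \<omega>' (cz y)
          = arg_shift \<omega> (cz x) - arg_shift \<omega>' (cz x)"
        using x b nz by (intro eventually_arg_shift_cz) (auto simp: i j)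
      then show ?thesis
        unfolding eq by eventually_elim simp
    next
      assume b: "\<not> b" "\<not> b'"
      have "- J y + int p * arg_shift \<omega> (cw y) - (- J y + int p * arg_shift \<omega>' (cw y))
          = int p * (arg_shift \<omega> (cw y) - arg_shift \<omega>' (cw y))" for y
        by (simp add: algebra_simps)
      then have eq: "chart_value H P Q i y \<otimes>\<^bsub>H\<^esub> inv\<^bsub>H\<^esub> chart_value H P Q j y
          = Q [^]\<^bsub>H\<^esub> (int p * (arg_shift \<omega> (cw y) - arg_shift \<omega>' (cw y)))" for y
        using b by (simp add: i j diff PQ)
      have "\<forall>\<^sub>F y in nhds x. y \<in> E \<longrightarrow> arg_shift \<omega> (cw y) - arg_shift \<omega>' (cw y)
          = arg_shift \<omega> (cw x) - arg_shift \<omega>' (cw x)"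
        using x b nz by (intro eventually_arg_shift_cw) (auto simp: i j)
      then show ?thesis
        unfolding eq by eventually_elim simp
    next
      assume b: "b" "\<not> b'"
      then have "\<forall>\<^sub>F y in nhds x. y \<in> E \<longrightarrow>
          chart_value H P Q i y = chart_value H P Q i x \<and> chart_value H P Q j y = chart_value H P Q j x"
        using chart_value_overlap[OF assms, of x \<omega> \<omega>'] x nz by (simp add: i j)
      then show ?thesis
        by eventually_elim simp
    next
      assume b: "\<not> b" "b'"
      then have "\<forall>\<^sub>F y in nhds x. y \<in> E \<longrightarrow>
          chart_value H P Q j y = chart_value H P Q j x \<and> chart_value H P Q i y = chart_value H P Q i x"
        using chart_value_overlap[OF assms, of x \<omega>' \<omega>] x nz by (simp add: i j)
      then show ?thesis
        by eventually_elim simp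
    qed
  qed
qed

section \<open>Holonomy of the meridian and of the fibre\<close>

lemma Arg_tube:
  assumes "norm v = 1"
  shows "Arg (cz (\<phi> (1, v))) = - real q * Re v / N" "Arg (cw (\<phi> (1, v))) = real p * Re v / N"
    "cz (\<phi> (1, v)) \<notin> \<real>\<^sub>\<le>\<^sub>0" "cw (\<phi> (1, v)) \<notin> \<real>\<^sub>\<le>\<^sub>0"
proof -
  have Re: "\<bar>Re v\<bar> \<le> 1" and Im: "\<bar>Im v\<bar> \<le> 1"
    using assms abs_Re_le_cmod[of v] abs_Im_le_cmod[of v] by auto
  have bound: "- pi < real n * Re v / N \<and> real n * Re v / N < pi" if n: "real n \<le> N" for n
  proof -
    have "\<bar>real n * Re v / N\<bar> = real n * \<bar>Re v\<bar> / N"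
      using N_pos by (simp add: abs_mult)
    also have "\<dots> \<le> N * 1 / N"
      using n Re N_pos by (intro divide_right_mono mult_mono) auto
    also have "\<dots> < pi"
      using N_pos pi_gt3 by simp
    finally show ?thesis
      unfolding abs_less_iff by linarith
  qed
  have sq: "real n \<le> real n ^ 2" for n :: nat
    by (cases n) (auto simp: power2_eq_square)
  have qN: "real q \<le> N" and pN: "real p \<le> N"
    unfolding N_def using sq[of p] sq[of q] zero_le_power2[of "real p"] zero_le_power2[of "real q"]
    by linarith+
  have z: "cz (\<phi> (1, v)) = rcis (rz (Im v)) (- real q * Re v / N)"
    and w: "cw (\<phi> (1, v)) = rcis (rw (Im v)) (real p * Re v / N)"
    by (simp_all add: cz_tube cw_tube rcis_def)
  show Arg_z: "Arg (cz (\<phi> (1, v))) = - real q * Re v / N"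
    and Arg_w: "Arg (cw (\<phi> (1, v))) = real p * Re v / N"
    unfolding z w using bound[OF qN] bound[OF pN] radii_pos[OF Im]
    by (auto intro!: Arg_rcis)
  have nonpos: "Arg z = pi \<or> z = 0" if "z \<in> \<real>\<^sub>\<le>\<^sub>0" for z
    using that by (auto simp: complex_nonpos_Reals_iff Arg_eq_pi complex_eq_iff)
  show "cz (\<phi> (1, v)) \<notin> \<real>\<^sub>\<le>\<^sub>0" "cw (\<phi> (1, v)) \<notin> \<real>\<^sub>\<le>\<^sub>0"
    using nonpos[of "cz (\<phi> (1, v))"] nonpos[of "cw (\<phi> (1, v))"]
      bound[OF qN] bound[OF pN] radii_pos[OF Im]
    unfolding Arg_z Arg_w by (auto simp: z w)
qed

text \<open>On the meridian q \<alpha> - p \<beta> is - Re v, while the argument normalised to lie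
  between 0 and 2 pi is 2 pi - Re v or - Re v according to the sign of Re v. The axis Re v = 0 falls
  to - 1 because \<open>Arg\<close> of a negative real is pi.\<close>

lemma J_meridian:
  assumes "norm v = 1"
  shows "J (\<phi> (1, v)) = (if Re v \<ge> 0 then - 1 else 0)"
proof -
  have Re: "\<bar>Re v\<bar> \<le> 1" and Im: "\<bar>Im v\<bar> \<le> 1"
    using assms abs_Re_le_cmod[of v] abs_Im_le_cmod[of v] by auto
  have pos: "rz (Im v) ^ q * rw (Im v) ^ p > 0"
    using radii_pos[OF Im] by simp
  have "- (cz (\<phi> (1, v)) ^ q * cnj (cw (\<phi> (1, v)) ^ p))
      = - rcis (rz (Im v) ^ q * rw (Im v) ^ p) (- Re v)"
    unfolding cz_tube_power cw_tube_power
    by (simp add: rcis_def cis_cnj flip: cis_inverse)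
  also have "\<dots> = rcis (rz (Im v) ^ q * rw (Im v) ^ p)
      (if Re v \<ge> 0 then pi - Re v else - pi - Re v)"
    by (simp add: rcis_def complex_eq_iff cos_diff sin_diff)
  finally have Arg: "Arg (- (cz (\<phi> (1, v)) ^ q * cnj (cw (\<phi> (1, v)) ^ p)))
      = (if Re v \<ge> 0 then pi - Re v else - pi - Re v)"
    using Re pos pi_gt3 by (auto simp: Arg_rcis)
  have nz: "cz (\<phi> (1, v)) \<noteq> 0" "cw (\<phi> (1, v)) \<noteq> 0"
    using Arg_tube(3,4)[OF assms] by auto
  have "real q * (- real q * Re v / N) - real p * (real p * Re v / N) = - Re v"
    using N_pos by (simp add: field_simps) (simp add: N_def power2_eq_square algebra_simps)
  then have "of_int (J (\<phi> (1, v))) * (2 * pi)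
      = - Re v - ((if Re v \<ge> 0 then pi - Re v else - pi - Re v) + pi)"
    using J_eq[OF nz] Arg Arg_tube(1,2)[OF assms] by simp
  then have "of_int (J (\<phi> (1, v))) * (2 * pi) = of_int (if Re v \<ge> 0 then - 1 else 0) * (2 * pi)"
    by simp
  then show ?thesis
    by (simp only: mult_cancel_right of_int_eq_iff) simp
qed

text \<open>The quotient of \<open>cw ^ p\<close> by \<open>cz ^ q\<close> is real only at v = \<i>
  and v = - \<i>; there it is less than 1 and greater than 1 respectively, so each point misses just
  one torus.\<close>

lemma meridian_domain:
  assumes "norm v = 1"
  shows "v \<noteq> - \<i> \<Longrightarrow> \<phi> (1, v) \<in> chart_domain (True, 1)"
    "v \<noteq> \<i> \<Longrightarrow> \<phi> (1, v) \<in> chart_domain (False, 1)"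
proof -
  have Re: "\<bar>Re v\<bar> \<le> 1" and Im: "\<bar>Im v\<bar> \<le> 1" and sum: "Re v ^ 2 + Im v ^ 2 = 1"
    using assms abs_Re_le_cmod[of v] abs_Im_le_cmod[of v] cmod_power2[of v] by auto
  define a b where "a = rz (Im v) ^ q" and "b = rw (Im v) ^ p"
  have pos: "a > 0" "b > 0"
    using radii_pos[OF Im] by (simp_all add: a_def b_def)
  have z: "(cw (\<phi> (1, v)) ^ p - cz (\<phi> (1, v)) ^ q) * cnj (cz (\<phi> (1, v)) ^ q)
      = of_real (a * b) * cis (Re v) - of_real (a ^ 2)"
    and w: "(cz (\<phi> (1, v)) ^ q - cw (\<phi> (1, v)) ^ p) * cnj (cw (\<phi> (1, v)) ^ p)
      = of_real (a * b) * cis (- Re v) - of_real (b ^ 2)"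
    unfolding cz_tube_power cw_tube_power
    by (simp_all add: cis_cnj cis_mult algebra_simps power2_eq_square flip: a_def b_def)
  have sin: "sin (Re v) \<noteq> 0" if "Re v \<noteq> 0"
  proof -
    have "sin \<bar>Re v\<bar> > 0"
      using that Re pi_gt3 by (intro sin_gt_zero) auto
    then show ?thesis
      by (auto simp: abs_if split: if_splits)
  qed
  have axis: "v = \<i> \<or> v = - \<i>" if "Re v = 0"
    using sum that by (auto simp: power2_eq_1_iff complex_eq_iff)
  have "of_real (a * b) * cis (Re v) - of_real (a ^ 2) \<notin> \<real>\<^sub>\<ge>\<^sub>0" if v: "v \<noteq> - \<i>"
  proof (cases "Re v = 0")
    case True
    then have "v = \<i>"
      using axis v by blast
    then have "b < a"
      using radii_less(1)[of 1] by (simp add: a_def b_def)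
    then have "a * b < a * a"
      using pos by simp
    then show ?thesis
      using True by (simp add: complex_nonneg_Reals_iff power2_eq_square)
  next
    case False
    then show ?thesis
      using sin pos by (simp add: complex_nonneg_Reals_iff)
  qed
  then show "\<phi> (1, v) \<in> chart_domain (True, 1)" if "v \<noteq> - \<i>"
    using that Arg_tube(3)[OF assms] assms
    by (simp add: torus_z_def z boundary_in_exterior del: complex_cnj_power)
  have "of_real (a * b) * cis (- Re v) - of_real (b ^ 2) \<notin> \<real>\<^sub>\<ge>\<^sub>0" if v: "v \<noteq> \<i>"
  proof (cases "Re v = 0")
    case True
    then have "v = - \<i>"
      using axis v by blast
    then have "a < b"
      using radii_less(2)[of "- 1"] by (simp add: a_def b_def)
    then have "a * b < b * b"
      using pos by simp
    then show ?thesis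
      using True by (simp add: complex_nonneg_Reals_iff power2_eq_square)
  next
    case False
    then show ?thesis
      using sin pos by (simp add: complex_nonneg_Reals_iff)
  qed
  then show "\<phi> (1, v) \<in> chart_domain (False, 1)" if "v \<noteq> \<i>"
    using that Arg_tube(4)[OF assms] assms
    by (simp add: torus_w_def w boundary_in_exterior del: complex_cnj_power)
qed

lemma knot_group_representation:
  assumes "group H" and PQ: "P \<in> carrier H" "Q \<in> carrier H"
    and order: "P [^]\<^bsub>H\<^esub> p = \<one>\<^bsub>H\<^esub>" "Q [^]\<^bsub>H\<^esub> q = \<one>\<^bsub>H\<^esub>"
  obtains \<rho> where "\<rho> \<in> hom G H" "\<rho> (torus_class 0 1) = P \<otimes>\<^bsub>H\<^esub> Q" "\<rho> (torus_class 1 0) = \<one>\<^bsub>H\<^esub>"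
proof -
  interpret H: group H
    by fact
  interpret A: flat_atlas H E chart_index chart_domain "chart_value H P Q"
    by (rule flat_atlas_exterior) fact+
  obtain \<rho> where \<rho>: "\<rho> \<in> hom G H" "\<And>g. g \<in> loops_at E (\<phi> (1, 1)) \<Longrightarrow> \<rho> (path_class E g) = A.holonomy g"
    using A.holonomy_hom[of "\<phi> (1, 1)"] unfolding knot_group_def by metis
  have shift: "arg_shift 1 z = 0" for z
    by (simp add: arg_shift_def)
  define m where "m = torus_map \<circ> linepath (0, 0) (of_int 0, of_int 1)"
  have m: "m = (\<lambda>t. \<phi> (1, cis (2 * pi * t)))"
    by (auto simp: m_def torus_map_def linepath_def cis_zero)
  \<comment> \<open>\<open>F\<close> jumps together with \<open>J\<close>. The jump of
    \<open>J\<close> from - 1 to 0 after 1/4 occurs at v = \<i>, in \<open>torus_z\<close>, where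
    the chart is \<open>P\<close> to the power \<open>J\<close> and contributes a factor
    \<open>P\<close>. The jump back at 3/4 occurs at v = - \<i>, in \<open>torus_w\<close>, where
    the chart is \<open>Q\<close> to the power - \<open>J\<close> and contributes
    \<open>Q\<close>.\<close>
  define F where "F t = (if t \<le> 1 / 4 then \<one>\<^bsub>H\<^esub> else if t < 3 / 4 then P else P \<otimes>\<^bsub>H\<^esub> Q)" for t :: real
  have cos_le: "cos (2 * pi * t) \<ge> 0 \<longleftrightarrow> t \<le> 1 / 4 \<or> t \<ge> 3 / 4" if t: "t \<in> {0..1}" for t
  proof -
    consider "t \<le> 1 / 4" | "1 / 4 < t" "t < 3 / 4" | "t \<ge> 3 / 4"
      by linarith
    then show ?thesis
    proof cases
      case 1
      then have "2 * pi * t \<le> 2 * pi * (1 / 4)"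
        by (intro mult_left_mono) auto
      moreover have "2 * pi * t \<ge> 0"
        using t by simp
      ultimately have "cos (2 * pi * t) \<ge> 0"
        using pi_gt_zero by (intro cos_ge_zero) linarith+
      then show ?thesis
        using 1 by simp
    next
      case 2
      have "cos (2 * pi * t - pi) > 0"
      proof (rule cos_gt_zero_pi)
        have "2 * pi * (1 / 4) < 2 * pi * t" "2 * pi * t < 2 * pi * (3 / 4)"
          using 2 by (intro mult_strict_left_mono; simp)+
        then show "- (pi / 2) < 2 * pi * t - pi" "2 * pi * t - pi < pi / 2"
          by linarith+
      qed
      then have "cos (2 * pi * t) < 0"
        by (simp add: cos_diff)
      then show ?thesis
        using 2 by simp
    next
      case 3
      then have "2 * pi * (3 / 4) \<le> 2 * pi * t" "2 * pi * t \<le> 2 * pi * 1"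
        using t by (intro mult_left_mono; simp)+
      then have "cos (2 * pi * t - 2 * pi) \<ge> 0"
        using pi_gt_zero by (intro cos_ge_zero) linarith+
      then show ?thesis
        using 3 by (simp add: cos_diff)
    qed
  qed
  have J: "J (m t) = (if t \<le> 1 / 4 \<or> t \<ge> 3 / 4 then - 1 else 0)" if "t \<in> {0..1}" for t
    using J_meridian[of "cis (2 * pi * t)"] cos_le[OF that] by (simp add: m)
  have "A.horizontal {0..1} m F"
    unfolding A.horizontal_def
  proof (intro conjI ballI)
    show "continuous_on {0..1} m" "m ` {0..1} \<subseteq> E"
      using torus_loop[of 0 1] unfolding m_def[symmetric]
      by (auto simp: loops_at_def path_def path_image_def)
    show "F ` {0..1} \<subseteq> carrier H"
      using PQ by (auto simp: F_def)
    fix t :: real assume t: "t \<in> {0..1}"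
    show "\<exists>i\<in>chart_index. m t \<in> chart_domain i \<and> (\<forall>\<^sub>F s in nhds t. s \<in> {0..1} \<longrightarrow>
        F s \<otimes>\<^bsub>H\<^esub> inv\<^bsub>H\<^esub> chart_value H P Q i (m s) = F t \<otimes>\<^bsub>H\<^esub> inv\<^bsub>H\<^esub> chart_value H P Q i (m t))"
    proof (cases "t \<le> 1 / 2")
      case True
      have "sin (2 * pi * t) \<ge> 0"
        using t True mult_left_mono[of t "1 / 2" "2 * pi"] by (intro sin_ge_zero) auto
      then have "m t \<in> chart_domain (True, 1)"
        unfolding m by (intro meridian_domain) (auto simp: complex_eq_iff)
      moreover have "F s \<otimes>\<^bsub>H\<^esub> inv\<^bsub>H\<^esub> chart_value H P Q (True, 1) (m s) = P"
        if "s \<in> {0..1}" "s < 3 / 4" for s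
        using that J[OF that(1)] PQ by (auto simp: F_def shift H.int_pow_neg)
      moreover have "\<forall>\<^sub>F s in nhds t. s < 3 / 4"
        using True by (intro eventually_nhds_in_open[of "{..<3/4}", simplified]) auto
      ultimately show ?thesis
        using t True by (intro bexI[of _ "(True, 1)"] conjI)
          (auto simp: chart_index_def simp del: chart_value.simps elim!: eventually_mono)
    next
      case False
      have "sin (2 * pi * t - pi) \<ge> 0"
        using t False mult_left_mono[of t "1" "2 * pi"] mult_left_mono[of "1 / 2" t "2 * pi"]
        by (intro sin_ge_zero) auto
      then have "sin (2 * pi * t) \<le> 0"
        by (simp add: sin_diff)
      then have "m t \<in> chart_domain (False, 1)"
        unfolding m by (intro meridian_domain) (auto simp: complex_eq_iff)
      moreover have "F s \<otimes>\<^bsub>H\<^esub> inv\<^bsub>H\<^esub> chart_value H P Q (False, 1) (m s) = P"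
        if "s \<in> {0..1}" "s > 1 / 4" for s
        using that J[OF that(1)] PQ by (auto simp: F_def shift H.m_assoc)
      moreover have "\<forall>\<^sub>F s in nhds t. s > 1 / 4"
        using False by (intro eventually_nhds_in_open[of "{1/4<..}", simplified]) auto
      ultimately show ?thesis
        using t False by (intro bexI[of _ "(False, 1)"] conjI)
          (auto simp: chart_index_def simp del: chart_value.simps elim!: eventually_mono)
    qed
  qed
  then have "A.holonomy m = P \<otimes>\<^bsub>H\<^esub> Q"
    using A.holonomy_eq[of m F] PQ by (simp add: F_def)
  then have meridian: "\<rho> (torus_class 0 1) = P \<otimes>\<^bsub>H\<^esub> Q"
    using \<rho>(2)[OF torus_loop[of 0 1]] by (simp add: torus_class_def m_def)
  define f where "f = torus_map \<circ> linepath (0, 0) (of_int 1, of_int 0)"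
  have f: "f = (\<lambda>t. \<phi> (cis (2 * pi * t), 1))"
    by (auto simp: f_def torus_map_def linepath_def cis_zero)
  have f_E: "continuous_on {0..1} f" "f ` {0..1} \<subseteq> E"
    using torus_loop[of 1 0] unfolding f_def[symmetric]
    by (auto simp: loops_at_def path_def path_image_def)
  \<comment> \<open>Along the fibre v = 1, so \<open>cz ^ q\<close> over \<open>cw ^ p\<close> is
    constantly \<open>cis (- 1)\<close> and the fibre stays in the overlap. There the chart values
    themselves are locally constant, hence a constant section is horizontal.\<close>
  have "A.horizontal {0..1} f (\<lambda>t. \<one>\<^bsub>H\<^esub>)"
    unfolding A.horizontal_def
  proof (intro conjI ballI)
    fix t :: real assume t: "t \<in> {0..1}"
    have unit: "u ^ n * cnj u ^ n = 1" if "norm u = 1" for u :: complex and n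
      using that complex_norm_square[of u] by (simp flip: power_mult_distrib)
    have ez: "(cw (f t) ^ p - cz (f t) ^ q) * cnj (cz (f t) ^ q) = cis 1 - 1"
      unfolding f cz_tube_power cw_tube_power
      using unit[of "cis (2 * pi * t)" "p * q"]
      by (simp add: radii_zero algebra_simps cis_cnj cis_mult)
    have ew: "(cz (f t) ^ q - cw (f t) ^ p) * cnj (cw (f t) ^ p) = cis (- 1) - 1"
      unfolding f cz_tube_power cw_tube_power
      using unit[of "cis (2 * pi * t)" "p * q"]
      by (simp add: radii_zero algebra_simps cis_cnj cis_mult)
    have "sin (1 :: real) \<noteq> 0"
      using sin_gt_zero[of 1] pi_gt3 by simp
    then have "cis 1 - 1 \<notin> \<real>\<^sub>\<ge>\<^sub>0" "cis (- 1) - 1 \<notin> \<real>\<^sub>\<ge>\<^sub>0"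
      by (simp_all add: complex_nonneg_Reals_iff)
    moreover have "f t \<in> E"
      using f_E(2) t by blast
    ultimately have "f t \<in> torus_z" "f t \<in> torus_w"
      by (simp_all only: torus_z_def torus_w_def mem_Collect_eq ez ew simp_thms)
    then have nz: "cz (f t) \<noteq> 0" "cw (f t) \<noteq> 0"
      and dom: "f t \<in> chart_domain (True, cz (f t))" "f t \<in> chart_domain (False, cw (f t))"
      using cz_nonzero cw_nonzero by auto
    show "\<exists>i\<in>chart_index. f t \<in> chart_domain i \<and> (\<forall>\<^sub>F s in nhds t. s \<in> {0..1} \<longrightarrow>
        \<one>\<^bsub>H\<^esub> \<otimes>\<^bsub>H\<^esub> inv\<^bsub>H\<^esub> chart_value H P Q i (f s)
        = \<one>\<^bsub>H\<^esub> \<otimes>\<^bsub>H\<^esub> inv\<^bsub>H\<^esub> chart_value H P Q i (f t))"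
    proof (intro bexI conjI)
      show "f t \<in> chart_domain (True, cz (f t))" "(True, cz (f t)) \<in> chart_index"
        using dom nz by (auto simp: chart_index_def)
      show "\<forall>\<^sub>F s in nhds t. s \<in> {0..1} \<longrightarrow>
        \<one>\<^bsub>H\<^esub> \<otimes>\<^bsub>H\<^esub> inv\<^bsub>H\<^esub> chart_value H P Q (True, cz (f t)) (f s)
        = \<one>\<^bsub>H\<^esub> \<otimes>\<^bsub>H\<^esub> inv\<^bsub>H\<^esub> chart_value H P Q (True, cz (f t)) (f t)"
        using continuous_on_eventually_nhds[OF f_E(1) t chart_value_overlap[OF assms dom nz]]
        by eventually_elim (use f_E(2) in \<open>simp add: image_subset_iff del: chart_value.simps\<close>)
    qed
  qed (use f_E in auto)
  then have "A.holonomy f = \<one>\<^bsub>H\<^esub>"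
    using A.holonomy_eq[of f "\<lambda>t. \<one>\<^bsub>H\<^esub>"] by simp
  then have "\<rho> (torus_class 1 0) = \<one>\<^bsub>H\<^esub>"
    using \<rho>(2)[OF torus_loop[of 1 0]] by (simp add: torus_class_def f_def)
  with \<rho>(1) meridian show thesis
    using that by blast
qed

lemma meridian_order_quotient:
  fixes d :: int
  assumes "d \<ge> 2"
  shows "\<exists>N. N \<lhd> G \<and> torus_class 1 0 \<in> N \<and> torus_class 0 1 [^]\<^bsub>G\<^esub> d \<in> N \<and>
    (\<forall>k::int. torus_class 0 1 [^]\<^bsub>G\<^esub> k \<in> N \<longrightarrow> d dvd k)"
proof -
  interpret GL: group GL2
    by (rule group_GL2)
  have "nat d \<ge> 2"
    using assms by simp
  from triangle_group_representation[OF p q this]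
  obtain x y where xy: "x \<in> carrier GL2" "y \<in> carrier GL2"
    "x [^]\<^bsub>GL2\<^esub> p = \<one>\<^bsub>GL2\<^esub>" "y [^]\<^bsub>GL2\<^esub> q = \<one>\<^bsub>GL2\<^esub>"
    and power: "\<And>k::nat. (x \<otimes>\<^bsub>GL2\<^esub> y) [^]\<^bsub>GL2\<^esub> k \<in> scalar_mats \<longleftrightarrow> nat d dvd k"
    by blast
  obtain \<rho> where \<rho>: "\<rho> \<in> hom G GL2" "\<rho> (torus_class 0 1) = x \<otimes>\<^bsub>GL2\<^esub> y"
    "\<rho> (torus_class 1 0) = \<one>\<^bsub>GL2\<^esub>"
    using knot_group_representation[OF group_GL2 xy] by blast
  interpret \<rho>: group_hom G GL2 \<rho>
    using \<rho>(1) by unfold_locales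
  interpret S: normal scalar_mats GL2
    by (rule scalar_mats_normal)
  \<comment> \<open>The kernel of the induced map to PGL2, where the meridian has order exactly
    d.\<close>
  define N where "N = {g \<in> carrier G. \<rho> g \<in> scalar_mats}"
  have "N \<lhd> G"
    by (intro normal_invI subgroupI)
      (auto simp: N_def S.inv_op_closed2 intro!: exI[of _ "\<one>\<^bsub>G\<^esub>"])
  have pow: "\<rho> (torus_class 0 1 [^]\<^bsub>G\<^esub> k) = (x \<otimes>\<^bsub>GL2\<^esub> y) [^]\<^bsub>GL2\<^esub> k" for k :: nat
    by (simp add: \<rho>.hom_nat_pow torus_class_closed \<rho>(2))
  have N_iff: "torus_class 0 1 [^]\<^bsub>G\<^esub> k \<in> N \<longleftrightarrow> nat d dvd k" for k :: nat
    by (simp add: N_def torus_class_closed pow power)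
  have "d dvd k" if k: "torus_class 0 1 [^]\<^bsub>G\<^esub> k \<in> N" for k :: int
  proof -
    have "sgn k * k = \<bar>k\<bar>"
      by (simp add: abs_sgn mult.commute)
    then have "torus_class 0 1 [^]\<^bsub>G\<^esub> \<bar>k\<bar> \<in> N"
      using subgroup_int_pow_closed[OF normal_imp_subgroup[OF \<open>N \<lhd> G\<close>] k, of "sgn k"]
      by (simp add: int_pow_pow torus_class_closed mult.commute)
    then have "torus_class 0 1 [^]\<^bsub>G\<^esub> nat \<bar>k\<bar> \<in> N"
      using pow_nat[of "\<bar>k\<bar>"] by simp
    then have "nat d dvd nat \<bar>k\<bar>"
      unfolding N_iff .
    then show ?thesis
      using assms by (simp add: nat_dvd_iff)
  qed
  moreover have "torus_class 0 1 [^]\<^bsub>G\<^esub> d \<in> N"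
    using N_iff[of "nat d"] assms by (simp add: pow_nat)
  moreover have "torus_class 1 0 \<in> N"
    by (simp add: N_def torus_class_closed \<rho>(3))
  ultimately show ?thesis
    using \<open>N \<lhd> G\<close> by blast
qed

end


section \<open>Chains of slopes\<close>

theorem theorem1p11:
  fixes p q :: nat
    and G :: "(real \<Rightarrow> complex \<times> complex) set monoid"
    and \<mu> l :: "(real \<Rightarrow> complex \<times> complex) set"
  assumes "q \<ge> 2" and "p > q" and "coprime p q"
    and "G = knot_group (torus_knot_tube p q)"
    and "preferred_pair (torus_knot_tube p q) \<mu> l"
  shows "\<not> (\<exists>r :: nat \<Rightarrow> slope. inj r \<and>
              (\<forall>i. slope_closure G \<mu> l (r i) \<subseteq> slope_closure G \<mu> l (r (Suc i))))
       \<and> (\<forall>r :: rat. finite_surgery_slope G \<mu> l (Rational r) \<longrightarrow>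
            (\<exists>s :: nat \<Rightarrow> slope. inj s \<and> s 0 = Rational r \<and>
              (\<forall>i. slope_closure G \<mu> l (s (Suc i)) \<subseteq> slope_closure G \<mu> l (s i))))"
proof -
  interpret K: torus_knot_exterior p q
    by unfold_locales (use assms in auto)
  obtain lk :: "(real \<Rightarrow> complex \<times> complex) set \<Rightarrow> int"
    where lk: "\<And>x y. x \<in> carrier K.G \<Longrightarrow> y \<in> carrier K.G \<Longrightarrow> lk (x \<otimes>\<^bsub>K.G\<^esub> y) = lk x + lk y"
      "lk (K.torus_class 0 1) = 1" "lk (K.torus_class 1 0) = int (p * q)"
    using K.linking_number by blast
  interpret S: slope_group K.G "K.torus_class 0 1" "K.torus_class 1 0" lk "int (p * q)"
    by unfold_locales
      (use assms lk K.torus_class_closed K.fibre_central K.meridian_order_quotient in auto)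
  have \<mu>: "\<mu> = K.torus_class 0 1"
    using assms(5) by (simp add: preferred_pair_def K.meridian_eq)
  obtain k where k: "l = K.torus_class 1 k"
    using assms(5) by (auto simp: preferred_pair_def K.longitude_eq)
  have l: "l = K.torus_class 1 0 \<otimes>\<^bsub>K.G\<^esub> K.torus_class 0 1 [^]\<^bsub>K.G\<^esub> k"
    using K.torus_class_mult[of 1 0 0 k] by (simp add: k K.torus_class_meridian_power[symmetric])
  \<comment> \<open>Linking numbers vanish on commutators, hence on the derived subgroup containing
    the preferred longitude. As \<open>l\<close> is the fibre times \<mu>^k, its linking number is
    pq + k, which fixes k.\<close>
  have "subgroup {g \<in> carrier K.G. lk g = 0} K.G"
    by (rule K.subgroupI) (auto simp: lk(1) S.lk_inv S.lk_one intro!: exI[of _ "\<one>\<^bsub>K.G\<^esub>"])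
  then have "generate K.G (derived_set K.G (carrier K.G)) \<subseteq> {g \<in> carrier K.G. lk g = 0}"
    by (intro K.generate_subgroup_incl) (auto simp: lk(1) S.lk_inv)
  then have "lk l = 0"
    using assms(5) by (auto simp: preferred_pair_def derived_def)
  then have "k = - int (p * q)"
    using lk by (simp add: l S.lk_pow K.torus_class_closed)
  with l have l': "l = K.torus_class 1 0 \<otimes>\<^bsub>K.G\<^esub> K.torus_class 0 1 [^]\<^bsub>K.G\<^esub> (- int (p * q))"
    by simp
  show ?thesis
    using S.no_ascending_chain[OF l'] S.descending_chain[OF l']
    unfolding assms(4) \<mu> finite_surgery_slope_def surgery_group_def by blast
qed

end
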